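(* Let $G$ and $G'$ be finite groups and let $C=(\mathcal X,\mathcal K)$ and $C'=(\mathcal X',\mathcal K')$ be supercharacter theories of $G$ and $G'$ respectively. Then $G$ is $C$-almost monomial and $G'$ is $C'$-almost monomial if and only if $G\times G'$ is $C\times C'$-almost monomial.
   Context: $\operatorname{Irr}(G)$ is the set of complex irreducible characters; $\lambda^G$ denotes induction. A supercharacter theory of $G$ is a pair $C=(\mathcal X,\mathcal K)$ with $\mathcal X$ a partition of $\operatorname{Irr}(G)$ and $\mathcal K$ a partition of $G$ such that $\{1\}\in\mathcal K$, $|\mathcal X|=|\mathcal K|$, and for each $X\in\mathcal X$ the character $\sigma_X=\sum_{\psi\in X}\psi(1)\psi$ is constant on each $K\in\mathcal K$. Given $C$ with $\mathcal X=\{X_1,\ldots,X_m\}$, $G$ is $C$-almost monomial if for any $k\neq\ell$ there exist subgroups $H_1,\ldots,H_t\leqslant G$ and linear characters $\lambda_i$ of $H_i$ with $\lambda_1^G+\cdots+\lambda_t^G=\sum_{i=1}^m\alpha_i\sigma_{X_i}$ for integers $\alpha_i\geq0$, $\alpha_k>0$, $\alpha_\ell=0$. The product theory $C\times C'=(\mathcal X\times\mathcal X',\mathcal K\times\mathcal K')$ of $G\times G'$ has parts $X\times X'=\{\chi\times\chi':\chi\in X,\chi'\in X'\}$ for $X\in\mathcal X$, $X'\in\mathcal X'$, and superclasses $K\times K'$; it is a supercharacter theory of $G\times G'$. *)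

theory Defs
  imports
    "HOL-Algebra.Group"
    "HOL-Library.Disjoint_Sets"
    "Jordan_Normal_Form.VS_Connect"
begin

(* The units of the n x n matrix ring form GL_n(C). *)
definition matrix_representation ::
    "('a, 'm) monoid_scheme \<Rightarrow> nat \<Rightarrow> ('a \<Rightarrow> complex mat) \<Rightarrow> bool" where
  "matrix_representation G n \<rho> \<longleftrightarrow> \<rho> \<in> hom G (units_of (ring_mat TYPE(complex) n ()))"

definition irreducible_representation ::
    "('a, 'm) monoid_scheme \<Rightarrow> nat \<Rightarrow> ('a \<Rightarrow> complex mat) \<Rightarrow> bool" where
  "irreducible_representation G n \<rho> \<longleftrightarrow>
     matrix_representation G n \<rho> \<and> n > 0 \<and>
     (\<forall>W. VectorSpace.subspace class_ring W (module_vec TYPE(complex) n) \<and>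
          (\<forall>g \<in> carrier G. \<forall>w \<in> W. \<rho> g *\<^sub>v w \<in> W)
        \<longrightarrow> W = {0\<^sub>v n} \<or> W = carrier_vec n)"

definition mat_trace :: "complex mat \<Rightarrow> complex" where
  "mat_trace A = (\<Sum>i < dim_row A. A $$ (i, i))"

(* Characters are total functions on the ambient type, set to 0 off the group. Thus equality of
   HOL functions is equality of characters, also for a character of a subgroup H, which is a
   character of G\<lparr>carrier := H\<rparr> and vanishes off H. *)
definition character_of ::
    "('a, 'm) monoid_scheme \<Rightarrow> ('a \<Rightarrow> complex mat) \<Rightarrow> 'a \<Rightarrow> complex" where
  "character_of G \<rho> g = (if g \<in> carrier G then mat_trace (\<rho> g) else 0)"

definition is_character :: "('a, 'm) monoid_scheme \<Rightarrow> ('a \<Rightarrow> complex) \<Rightarrow> bool" where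
  "is_character G \<chi> \<longleftrightarrow> (\<exists>n \<rho>. matrix_representation G n \<rho> \<and> \<chi> = character_of G \<rho>)"

definition Irr :: "('a, 'm) monoid_scheme \<Rightarrow> ('a \<Rightarrow> complex) set" where
  "Irr G = {character_of G \<rho> | n \<rho>. irreducible_representation G n \<rho>}"

definition linear_character :: "('a, 'm) monoid_scheme \<Rightarrow> ('a \<Rightarrow> complex) \<Rightarrow> bool" where
  "linear_character G \<mu> \<longleftrightarrow> is_character G \<mu> \<and> \<mu> \<one>\<^bsub>G\<^esub> = 1"

definition induced ::
    "('a, 'm) monoid_scheme \<Rightarrow> 'a set \<Rightarrow> ('a \<Rightarrow> complex) \<Rightarrow> 'a \<Rightarrow> complex" where
  "induced G H \<phi> g =
     (if g \<in> carrier G then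
        (\<Sum>x \<in> carrier G.
           if x \<otimes>\<^bsub>G\<^esub> g \<otimes>\<^bsub>G\<^esub> inv\<^bsub>G\<^esub> x \<in> H
           then \<phi> (x \<otimes>\<^bsub>G\<^esub> g \<otimes>\<^bsub>G\<^esub> inv\<^bsub>G\<^esub> x) else 0) / of_nat (card H)
      else 0)"

definition supercharacter ::
    "('a, 'm) monoid_scheme \<Rightarrow> ('a \<Rightarrow> complex) set \<Rightarrow> 'a \<Rightarrow> complex" where
  "supercharacter G X g = (\<Sum>\<psi> \<in> X. \<psi> \<one>\<^bsub>G\<^esub> * \<psi> g)"

type_synonym 'a sct = "('a \<Rightarrow> complex) set set \<times> 'a set set"

definition supercharacter_theory :: "('a, 'm) monoid_scheme \<Rightarrow> 'a sct \<Rightarrow> bool" where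
  "supercharacter_theory G C \<longleftrightarrow>
     partition_on (Irr G) (fst C) \<and>
     partition_on (carrier G) (snd C) \<and>
     {\<one>\<^bsub>G\<^esub>} \<in> snd C \<and>
     card (fst C) = card (snd C) \<and>
     (\<forall>X \<in> fst C. \<forall>K \<in> snd C. \<forall>g \<in> K. \<forall>h \<in> K. supercharacter G X g = supercharacter G X h)"

(* The parts X, Y play the roles of X_k, X_l; the coefficients are indexed by the parts. *)
definition almost_monomial :: "('a, 'm) monoid_scheme \<Rightarrow> 'a sct \<Rightarrow> bool" where
  "almost_monomial G C \<longleftrightarrow>
     (\<forall>X \<in> fst C. \<forall>Y \<in> fst C. X \<noteq> Y \<longrightarrow>
        (\<exists>(t :: nat) H \<mu> (\<alpha> :: ('a \<Rightarrow> complex) set \<Rightarrow> int).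
           (\<forall>i \<in> {1..t}. subgroup (H i) G \<and> linear_character (G\<lparr>carrier := H i\<rparr>) (\<mu> i)) \<and>
           (\<forall>g \<in> carrier G. (\<Sum>i = 1..t. induced G (H i) (\<mu> i) g) =
              (\<Sum>Z \<in> fst C. of_int (\<alpha> Z) * supercharacter G Z g)) \<and>
           (\<forall>Z \<in> fst C. \<alpha> Z \<ge> 0) \<and> \<alpha> X > 0 \<and> \<alpha> Y = 0))"

definition char_prod :: "('a \<Rightarrow> complex) \<Rightarrow> ('b \<Rightarrow> complex) \<Rightarrow> 'a \<times> 'b \<Rightarrow> complex" where
  "char_prod \<chi> \<chi>' = (\<lambda>(g, g'). \<chi> g * \<chi>' g')"

definition product_theory :: "'a sct \<Rightarrow> 'b sct \<Rightarrow> ('a \<times> 'b) sct" where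
  "product_theory C C' =
     ({{char_prod \<chi> \<chi>' | \<chi> \<chi>'. \<chi> \<in> X \<and> \<chi>' \<in> X'} | X X'. X \<in> fst C \<and> X' \<in> fst C'},
      {K \<times> K' | K K'. K \<in> snd C \<and> K' \<in> snd C'})"

end

theory Submission
  imports Defs "Jordan_Normal_Form.Spectral_Radius" "HOL-Library.Function_Algebras"
begin

text \<open>
  Products of induced linear characters are induced linear characters of the product group, which
  gives one direction; if only one of the two coordinates of the parts to be separated differs, the
  other coordinate merely needs a sum of induced linear characters in which the given part occurs.

  Conversely, averaging a character of \<open>G \<times> G'\<close> over \<open>G'\<close> (deflation) keeps exactly the terms
  \<open>\<sigma>\<^sub>Z \<times> \<sigma>\<^sub>T\<close> for the part \<open>T\<close> of \<open>C'\<close> that contains the trivial character, with unchanged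
  coefficients, by orthogonality with the trivial character. The deflation of a character induced from
  a linear character \<open>\<mu>\<close> of \<open>S\<close> is zero if \<open>\<mu>\<close> is nontrivial on the kernel, and otherwise it is
  induced from the linear character of the image of \<open>S\<close> through which \<open>\<mu>\<close> factors.

  Orthogonality of irreducible characters also yields that there are finitely many of them and
  that distinct pairs of parts have distinct products.
\<close>

section \<open>Irreducible characters\<close>

lemma matrix_representationD:
  assumes "group G" "matrix_representation G n \<rho>"
  shows matrix_representation_carrier: "\<And>g. g \<in> carrier G \<Longrightarrow> \<rho> g \<in> carrier_mat n n"
    and matrix_representation_mult:
      "\<And>g h. g \<in> carrier G \<Longrightarrow> h \<in> carrier G \<Longrightarrow> \<rho> (g \<otimes>\<^bsub>G\<^esub> h) = \<rho> g * \<rho> h"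
    and matrix_representation_one: "\<rho> \<one>\<^bsub>G\<^esub> = 1\<^sub>m n"
proof -
  let ?R = "ring_mat TYPE(complex) n ()"
  interpret R: ring ?R by (rule ring_mat)
  have hom: "\<rho> \<in> hom G (units_of ?R)"
    using assms(2) by (simp add: matrix_representation_def)
  show "\<And>g. g \<in> carrier G \<Longrightarrow> \<rho> g \<in> carrier_mat n n"
    using hom by (auto simp: hom_def units_of_carrier Units_def ring_mat_simps)
  show "\<And>g h. g \<in> carrier G \<Longrightarrow> h \<in> carrier G \<Longrightarrow> \<rho> (g \<otimes>\<^bsub>G\<^esub> h) = \<rho> g * \<rho> h"
    using hom_mult[OF hom] by (auto simp: units_of_mult ring_mat_simps)
  show "\<rho> \<one>\<^bsub>G\<^esub> = 1\<^sub>m n"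
    using hom_one[OF hom assms(1) R.units_group] by (simp add: units_of_one ring_mat_simps)
qed

lemma matrix_representationI:
  assumes "group G"
    and car: "\<And>g. g \<in> carrier G \<Longrightarrow> \<rho> g \<in> carrier_mat n n"
    and mult: "\<And>g h. g \<in> carrier G \<Longrightarrow> h \<in> carrier G \<Longrightarrow> \<rho> (g \<otimes>\<^bsub>G\<^esub> h) = \<rho> g * \<rho> h"
    and one: "\<rho> \<one>\<^bsub>G\<^esub> = 1\<^sub>m n"
  shows "matrix_representation G n \<rho>"
proof -
  interpret group G by fact
  have "\<rho> g \<in> Units (ring_mat TYPE(complex) n ())" if g: "g \<in> carrier G" for g
  proof -
    have "\<rho> (inv\<^bsub>G\<^esub> g) * \<rho> g = 1\<^sub>m n" "\<rho> g * \<rho> (inv\<^bsub>G\<^esub> g) = 1\<^sub>m n"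
      using g mult one by (metis inv_closed l_inv, metis inv_closed r_inv)
    then show ?thesis
      using car g unfolding Units_def ring_mat_simps by (auto intro!: bexI[of _ "\<rho> (inv\<^bsub>G\<^esub> g)"])
  qed
  then show ?thesis
    using mult by (auto simp: matrix_representation_def hom_def units_of_carrier units_of_mult ring_mat_simps)
qed

section \<open>Schur's lemma\<close>

lemma subspace_carrier_vecI:
  assumes "W \<subseteq> carrier_vec n" "0\<^sub>v n \<in> W"
    and "\<And>v w. v \<in> W \<Longrightarrow> w \<in> W \<Longrightarrow> v + w \<in> W"
    and "\<And>c v. v \<in> W \<Longrightarrow> c \<cdot>\<^sub>v v \<in> W"
  shows "VectorSpace.subspace class_ring W (module_vec TYPE(complex) n)"
  unfolding VectorSpace.subspace_def submodule_def
  using assms vec_vs[of n, where ?'a = complex] vec_module[of n, where ?'a = complex]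
  by (auto simp: module_vec_simps)

lemma mult_mat_vec_zero:
  "A \<in> carrier_mat m n \<Longrightarrow> A *\<^sub>v 0\<^sub>v n = 0\<^sub>v m" for A :: "'a :: semiring_0 mat"
  by (intro eq_vecI) auto

text \<open>First half of Schur's lemma: the kernel and the image of \<open>T\<close> are invariant
  subspaces, so a nonzero \<open>T\<close> has zero kernel and full image. A two-sided inverse
  matrix is produced because \<open>n = m\<close> is not known beforehand.\<close>

lemma irreducible_representation_intertwiner_inverse:
  assumes G: "group G"
    and irr: "irreducible_representation G n \<rho>" "irreducible_representation G m \<sigma>"
    and T: "T \<in> carrier_mat n m" "T \<noteq> 0\<^sub>m n m"
    and comm: "\<And>g. g \<in> carrier G \<Longrightarrow> \<rho> g * T = T * \<sigma> g"
  obtains S where "S \<in> carrier_mat m n" "T * S = 1\<^sub>m n" "S * T = 1\<^sub>m m"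
proof -
  have rep: "matrix_representation G n \<rho>" "matrix_representation G m \<sigma>"
    using irr by (auto simp: irreducible_representation_def)
  note car = matrix_representation_carrier[OF G rep(1)] matrix_representation_carrier[OF G rep(2)]
  define K where "K = {v \<in> carrier_vec m. T *\<^sub>v v = 0\<^sub>v n}"
  define I where "I = (\<lambda>v. T *\<^sub>v v) ` carrier_vec m"
  have colT: "T *\<^sub>v unit_vec m j = col T j" if "j < m" for j
    using T(1) that by (intro eq_vecI) auto
  have comm': "\<rho> g *\<^sub>v (T *\<^sub>v v) = T *\<^sub>v (\<sigma> g *\<^sub>v v)" if "g \<in> carrier G" "v \<in> carrier_vec m" for g v
    using comm[OF that(1)] car that T(1) by (metis assoc_mult_mat_vec)
  have "VectorSpace.subspace class_ring K (module_vec TYPE(complex) m)"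
    unfolding K_def using T(1)
    by (intro subspace_carrier_vecI) (auto simp: mult_add_distrib_mat_vec mult_mat_vec)
  moreover have "\<sigma> g *\<^sub>v v \<in> K" if "g \<in> carrier G" "v \<in> K" for g v
    using that comm'[of g v] car[of g] mult_mat_vec_zero[OF car(1)[of g]] by (auto simp: K_def)
  ultimately have "K = {0\<^sub>v m} \<or> K = carrier_vec m"
    using irr(2) by (auto simp: irreducible_representation_def)
  moreover have "K \<noteq> carrier_vec m"
  proof
    assume K: "K = carrier_vec m"
    have "T = 0\<^sub>m n m"
    proof (rule eq_matI)
      fix i j assume ij: "i < dim_row (0\<^sub>m n m :: complex mat)" "j < dim_col (0\<^sub>m n m :: complex mat)"
      have "unit_vec m j \<in> K" unfolding K by simp
      then have "col T j = 0\<^sub>v n" using colT[of j] ij by (simp add: K_def)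
      then show "T $$ (i, j) = 0\<^sub>m n m $$ (i, j)"
        using ij T(1) by (metis carrier_matD index_col index_zero_mat index_zero_vec(1))
    qed (use T in auto)
    with T(2) show False by simp
  qed
  ultimately have K: "K = {0\<^sub>v m}" by simp
  have "VectorSpace.subspace class_ring I (module_vec TYPE(complex) n)"
  proof (rule subspace_carrier_vecI)
    show "I \<subseteq> carrier_vec n" using T(1) by (auto simp: I_def)
    show "0\<^sub>v n \<in> I" unfolding I_def using T(1) by (intro image_eqI[of _ _ "0\<^sub>v m"]) auto
    show "v + w \<in> I" if "v \<in> I" "w \<in> I" for v w
      using that T(1) by (auto simp: I_def mult_add_distrib_mat_vec[symmetric])
    show "c \<cdot>\<^sub>v v \<in> I" if "v \<in> I" for c v
      using that T(1) by (auto simp: I_def mult_mat_vec[symmetric])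
  qed
  moreover have "\<rho> g *\<^sub>v v \<in> I" if "g \<in> carrier G" "v \<in> I" for g v
    using that comm'[of g] car[of g] by (auto simp: I_def)
  ultimately have "I = {0\<^sub>v n} \<or> I = carrier_vec n"
    using irr(1) by (auto simp: irreducible_representation_def)
  moreover have "I \<noteq> {0\<^sub>v n}"
    using \<open>K \<noteq> carrier_vec m\<close> by (auto simp: I_def K_def)
  ultimately have I: "I = carrier_vec n" by simp
  have "\<exists>s. s \<in> carrier_vec m \<and> T *\<^sub>v s = unit_vec n j" for j
  proof -
    have "unit_vec n j \<in> I" unfolding I by simp
    then show ?thesis unfolding I_def by (metis imageE)
  qed
  then obtain s where s: "\<And>j. s j \<in> carrier_vec m" "\<And>j. T *\<^sub>v s j = unit_vec n j" by metis
  \<comment> \<open>The columns of the inverse are preimages of the unit vectors, which exist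
    because the image is everything.\<close>
  define S where "S = mat_of_cols m (map s [0..<n])"
  have S: "S \<in> carrier_mat m n" by (simp add: S_def carrier_matI)
  have colS: "col S j = s j" if "j < n" for j using that s by (simp add: S_def)
  have TS: "T * S = 1\<^sub>m n"
  proof (rule mat_col_eqI)
    fix j assume "j < dim_col (1\<^sub>m n :: complex mat)"
    then have "j < n" by simp
    then show "col (T * S) j = col (1\<^sub>m n) j"
      by (simp only: col_mult2[OF T(1) S] colS s(2) col_one)
  qed (use S T in auto)
  \<comment> \<open>So far \<open>S\<close> is only a right inverse. Since \<open>T\<close> is
    injective, comparing \<open>T\<close> applied to both columns makes it a left inverse as
    well.\<close>
  have ST: "S * T = 1\<^sub>m m"
  proof (rule mat_col_eqI)
    fix j assume "j < dim_col (1\<^sub>m m :: complex mat)"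
    then have j: "j < m" by simp
    have c: "col T j \<in> carrier_vec n" using T j by auto
    have d: "S *\<^sub>v col T j \<in> carrier_vec m" using S c by (rule mult_mat_vec_carrier)
    have "T *\<^sub>v (S *\<^sub>v col T j) = col T j"
      using TS T(1) S c by (metis assoc_mult_mat_vec one_mult_mat_vec)
    then have "T *\<^sub>v (S *\<^sub>v col T j - unit_vec m j) = 0\<^sub>v n"
      using T(1) d c colT[OF j] by (subst mult_minus_distrib_mat_vec) auto
    then have "S *\<^sub>v col T j - unit_vec m j \<in> K"
      using d by (auto simp: K_def)
    then have "S *\<^sub>v col T j - unit_vec m j = 0\<^sub>v m" using K by simp
    then have "(S *\<^sub>v col T j) $ i = unit_vec m j $ i" if "i < m" for i
      using that S j by (metis (no_types, lifting) index_minus_vec(1) index_unit_vec(3) index_zero_vec(1) right_minus_eq)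
    then have "S *\<^sub>v col T j = unit_vec m j"
      using S by (intro eq_vecI) auto
    then show "col (S * T) j = col (1\<^sub>m m) j"
      using j by (simp only: col_mult2[OF S T(1)] col_one)
  qed (use S T in auto)
  show thesis using that S TS ST by blast
qed

section \<open>Sums of matrix coefficients and the orthogonality relations\<close>

lemma mat_trace_mult_commute:
  assumes "A \<in> carrier_mat n m" "B \<in> carrier_mat m n"
  shows "mat_trace (A * B) = mat_trace (B * A)"
proof -
  have "mat_trace (A * B) = (\<Sum>i<n. \<Sum>j<m. A $$ (i, j) * B $$ (j, i))"
    using assms by (simp add: mat_trace_def scalar_prod_def atLeast0LessThan)
  also have "\<dots> = (\<Sum>j<m. \<Sum>i<n. B $$ (j, i) * A $$ (i, j))"
    by (subst sum.swap) (simp add: mult.commute)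
  also have "\<dots> = mat_trace (B * A)"
    using assms by (simp add: mat_trace_def scalar_prod_def atLeast0LessThan)
  finally show ?thesis .
qed

text \<open>This is the sum of the matrices \<open>\<rho> g E \<sigma> (inv g)\<close> for the matrix unit \<open>E\<close> with entry 1 at \<open>(j, k)\<close>.\<close>

definition matrix_coefficient_sum ::
    "('a, 'm) monoid_scheme \<Rightarrow> nat \<Rightarrow> ('a \<Rightarrow> complex mat) \<Rightarrow> nat \<Rightarrow> ('a \<Rightarrow> complex mat) \<Rightarrow>
      nat \<Rightarrow> nat \<Rightarrow> complex mat" where
  "matrix_coefficient_sum G n \<rho> m \<sigma> j k =
     mat n m (\<lambda>(i, l). \<Sum>g \<in> carrier G. \<rho> g $$ (i, j) * \<sigma> (inv\<^bsub>G\<^esub> g) $$ (k, l))"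

lemma matrix_coefficient_sum_carrier [simp]:
  "matrix_coefficient_sum G n \<rho> m \<sigma> j k \<in> carrier_mat n m"
  by (simp add: matrix_coefficient_sum_def)

text \<open>Replacing the summation variable \<open>g\<close> by \<open>inv h \<otimes> g\<close>
  moves the factor belonging to \<open>h\<close> from the left of the sum to its right.\<close>

lemma matrix_coefficient_sum_intertwines:
  fixes G (structure)
  assumes G: "group G" "finite (carrier G)"
    and rep: "matrix_representation G n \<rho>" "matrix_representation G m \<sigma>"
    and jk: "j < n" "k < m" and h: "h \<in> carrier G"
  shows "\<rho> h * matrix_coefficient_sum G n \<rho> m \<sigma> j k = matrix_coefficient_sum G n \<rho> m \<sigma> j k * \<sigma> h"
    (is "_ * ?T = _")
proof (rule eq_matI)
  interpret group G by fact
  note car = matrix_representation_carrier[OF G(1) rep(1)] matrix_representation_carrier[OF G(1) rep(2)]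
  note mult = matrix_representation_mult[OF G(1) rep(1)] matrix_representation_mult[OF G(1) rep(2)]
  fix i l assume "i < dim_row (?T * \<sigma> h)" "l < dim_col (?T * \<sigma> h)"
  then have il: "i < n" "l < m" using car[OF h] by (auto simp: matrix_coefficient_sum_def)
  have entry: "(A * B) $$ (a, b) = (\<Sum>c<q. A $$ (a, c) * B $$ (c, b))"
    if "A \<in> carrier_mat p q" "B \<in> carrier_mat q r" "a < p" "b < r" for A B :: "complex mat" and p q r a b
    using that by (simp add: scalar_prod_def atLeast0LessThan)
  have "(\<rho> h * ?T) $$ (i, l) =
      (\<Sum>a<n. \<rho> h $$ (i, a) * (\<Sum>g\<in>carrier G. \<rho> g $$ (a, j) * \<sigma> (inv g) $$ (k, l)))"
    using il by (subst entry[OF car(1)[OF h] matrix_coefficient_sum_carrier]) (auto simp: matrix_coefficient_sum_def)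
  also have "\<dots> = (\<Sum>g\<in>carrier G. (\<Sum>a<n. \<rho> h $$ (i, a) * \<rho> g $$ (a, j)) * \<sigma> (inv g) $$ (k, l))"
    by (simp add: sum_distrib_left sum_distrib_right mult.assoc) (rule sum.swap)
  also have "\<dots> = (\<Sum>g\<in>carrier G. \<rho> (h \<otimes> g) $$ (i, j) * \<sigma> (inv g) $$ (k, l))"
    using il jk h by (intro sum.cong refl) (simp add: mult entry[OF car(1)[OF h] car(1)] del: index_mult_mat)
  also have "\<dots> = (\<Sum>g\<in>carrier G. \<rho> g $$ (i, j) * \<sigma> (inv g \<otimes> h) $$ (k, l))"
    using h by (intro sum.reindex_bij_witness[of _ "\<lambda>g. inv h \<otimes> g" "\<lambda>g. h \<otimes> g"])
      (auto simp: m_assoc[symmetric] inv_mult_group, auto simp: m_assoc)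
  also have "\<dots> = (\<Sum>g\<in>carrier G. \<rho> g $$ (i, j) * (\<Sum>b<m. \<sigma> (inv g) $$ (k, b) * \<sigma> h $$ (b, l)))"
    using il jk h by (intro sum.cong refl) (simp add: mult entry[OF car(2) car(2)] del: index_mult_mat)
  also have "\<dots> = (\<Sum>b<m. (\<Sum>g\<in>carrier G. \<rho> g $$ (i, j) * \<sigma> (inv g) $$ (k, b)) * \<sigma> h $$ (b, l))"
    by (simp add: sum_distrib_left sum_distrib_right mult.assoc) (rule sum.swap)
  also have "\<dots> = (?T * \<sigma> h) $$ (i, l)"
    using il by (subst entry[OF matrix_coefficient_sum_carrier car(2)[OF h]]) (auto simp: matrix_coefficient_sum_def)
  finally show "(\<rho> h * ?T) $$ (i, l) = (?T * \<sigma> h) $$ (i, l)" .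
qed (use matrix_representation_carrier[OF G(1) rep(1) h] matrix_representation_carrier[OF G(1) rep(2) h]
      in \<open>auto simp: matrix_coefficient_sum_def\<close>)

text \<open>Expanding both traces, the product of the diagonal entries \<open>(j, j)\<close> and
  \<open>(k, k)\<close> is a summand of the \<open>(j, k)\<close> entry of the sum for the matrix
  unit at \<open>(j, k)\<close>. This reduces orthogonality to knowing these intertwiners.\<close>

lemma sum_characters_eq_sum_matrix_coefficients:
  fixes G (structure)
  assumes G: "group G" "finite (carrier G)"
    and rep: "matrix_representation G n \<rho>" "matrix_representation G m \<sigma>"
  shows "(\<Sum>g\<in>carrier G. character_of G \<rho> g * character_of G \<sigma> (inv\<^bsub>G\<^esub> g)) =
    (\<Sum>j<n. \<Sum>k<m. matrix_coefficient_sum G n \<rho> m \<sigma> j k $$ (j, k))"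
proof -
  interpret group G by fact
  note car = matrix_representation_carrier[OF G(1) rep(1)] matrix_representation_carrier[OF G(1) rep(2)]
  have "(\<Sum>g\<in>carrier G. character_of G \<rho> g * character_of G \<sigma> (inv\<^bsub>G\<^esub> g)) =
      (\<Sum>g\<in>carrier G. \<Sum>j<n. \<Sum>k<m. \<rho> g $$ (j, j) * \<sigma> (inv g) $$ (k, k))"
  proof (rule sum.cong[OF refl])
    fix g assume "g \<in> carrier G"
    then show "character_of G \<rho> g * character_of G \<sigma> (inv g) =
        (\<Sum>j<n. \<Sum>k<m. \<rho> g $$ (j, j) * \<sigma> (inv g) $$ (k, k))"
      using car[of g] car[of "inv g"] by (simp add: character_of_def mat_trace_def sum_product)
  qed
  also have "\<dots> = (\<Sum>j<n. \<Sum>k<m. \<Sum>g\<in>carrier G. \<rho> g $$ (j, j) * \<sigma> (inv g) $$ (k, k))"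
    by (subst sum.swap) (intro sum.cong refl sum.swap)
  also have "\<dots> = (\<Sum>j<n. \<Sum>k<m. matrix_coefficient_sum G n \<rho> m \<sigma> j k $$ (j, k))"
    by (intro sum.cong refl) (simp add: matrix_coefficient_sum_def)
  finally show ?thesis .
qed

text \<open>Second half of Schur's lemma: over the complex numbers \<open>T\<close> has an
  eigenvalue \<open>c\<close>. Subtracting the scalar matrix \<open>c\<close> leaves an intertwiner
  that kills an eigenvector; it is not invertible, hence zero.\<close>

lemma irreducible_representation_commutant_scalar:
  assumes G: "group G" and irr: "irreducible_representation G n \<rho>"
    and T: "T \<in> carrier_mat n n"
    and comm: "\<And>g. g \<in> carrier G \<Longrightarrow> \<rho> g * T = T * \<rho> g"
  obtains c where "T = c \<cdot>\<^sub>m 1\<^sub>m n"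
proof -
  have n: "n > 0" and rep: "matrix_representation G n \<rho>"
    using irr by (auto simp: irreducible_representation_def)
  note car = matrix_representation_carrier[OF G rep]
  obtain c v where v: "v \<in> carrier_vec n" "v \<noteq> 0\<^sub>v n" "T *\<^sub>v v = c \<cdot>\<^sub>v v"
    using spectrum_non_empty[OF T n] T by (auto simp: spectrum_def eigenvalue_def eigenvector_def)
  define D where "D = T - c \<cdot>\<^sub>m 1\<^sub>m n"
  have D: "D \<in> carrier_mat n n" using minus_carrier_mat[of "c \<cdot>\<^sub>m 1\<^sub>m n" n n T] by (simp add: D_def)
  have "\<rho> g * D = D * \<rho> g" if g: "g \<in> carrier G" for g
    unfolding D_def using comm[OF g] car[OF g] T mult_smult_distrib[OF car[OF g] one_carrier_mat, of c]
    by (simp add: mult_minus_distrib_mat[of _ n n] minus_mult_distrib_mat[of _ n n]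
        mult_smult_assoc_mat[of _ n n])
  moreover have "D *\<^sub>v v = 0\<^sub>v n"
  proof -
    have "(c \<cdot>\<^sub>m 1\<^sub>m n) *\<^sub>v v = c \<cdot>\<^sub>v v"
      using v(1) by (intro eq_vecI) auto
    then show ?thesis
      using v T by (simp add: D_def minus_mult_distrib_mat_vec[of _ n n])
  qed
  moreover have "S * D \<noteq> 1\<^sub>m n" if "S \<in> carrier_mat n n" for S
  proof
    assume "S * D = 1\<^sub>m n"
    then have "v = S *\<^sub>v (D *\<^sub>v v)" using that D v by (metis assoc_mult_mat_vec one_mult_mat_vec)
    with \<open>D *\<^sub>v v = 0\<^sub>v n\<close> mult_mat_vec_zero[OF that] v(2) show False by simp
  qed
  ultimately have "D = 0\<^sub>m n n"
    using irreducible_representation_intertwiner_inverse[OF G irr irr D] by metis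
  then have "D $$ (i, j) = 0" if "i < n" "j < n" for i j
    using that by simp
  then have "T $$ (i, j) = (c \<cdot>\<^sub>m 1\<^sub>m n) $$ (i, j)" if "i < n" "j < n" for i j
    using that T by (fastforce simp: D_def)
  then have "T = c \<cdot>\<^sub>m 1\<^sub>m n" using T by (intro eq_matI) auto
  then show thesis by (rule that)
qed

lemma character_of_one:
  assumes "group G" "matrix_representation G n \<rho>"
  shows "character_of G \<rho> \<one>\<^bsub>G\<^esub> = of_nat n"
  using assms matrix_representation_one[OF assms] group.is_monoid[OF assms(1)]
  by (simp add: character_of_def mat_trace_def monoid.one_closed)

lemma IrrE:
  assumes "group G" "\<chi> \<in> Irr G"
  obtains n \<rho> where "irreducible_representation G n \<rho>" "matrix_representation G n \<rho>" "n > 0"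
    "\<chi> = character_of G \<rho>" "\<chi> \<one>\<^bsub>G\<^esub> = of_nat n"
proof -
  obtain n \<rho> where \<rho>: "irreducible_representation G n \<rho>" "\<chi> = character_of G \<rho>"
    using assms(2) by (auto simp: Irr_def)
  then have "matrix_representation G n \<rho>" "n > 0"
    by (auto simp: irreducible_representation_def)
  then show thesis
    using that \<rho> character_of_one[OF assms(1)] by blast
qed

text \<open>A nonzero matrix coefficient sum would be invertible and conjugate
  \<open>\<sigma>\<close> into \<open>\<rho>\<close>, so that the traces would agree. Hence all
  these sums vanish. With \<open>\<psi> (inv g)\<close> in place of a complex conjugate, no unitary
  structure enters.\<close>

theorem Irr_orthogonal:
  assumes G: "group G" "finite (carrier G)" and \<chi>: "\<chi> \<in> Irr G" and \<psi>: "\<psi> \<in> Irr G" and ne: "\<chi> \<noteq> \<psi>"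
  shows "(\<Sum>g\<in>carrier G. \<chi> g * \<psi> (inv\<^bsub>G\<^esub> g)) = 0"
proof -
  obtain n \<rho> where \<rho>: "irreducible_representation G n \<rho>" "matrix_representation G n \<rho>" "\<chi> = character_of G \<rho>"
    using G(1) \<chi> by (elim IrrE)
  obtain m \<sigma> where \<sigma>: "irreducible_representation G m \<sigma>" "matrix_representation G m \<sigma>" "\<psi> = character_of G \<sigma>"
    using G(1) \<psi> by (elim IrrE)
  have "matrix_coefficient_sum G n \<rho> m \<sigma> j k = 0\<^sub>m n m" (is "?T = _") if jk: "j < n" "k < m" for j k
  proof (rule ccontr)
    assume "?T \<noteq> 0\<^sub>m n m"
    then obtain S where S: "S \<in> carrier_mat m n" "?T * S = 1\<^sub>m n" "S * ?T = 1\<^sub>m m"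
      by (rule irreducible_representation_intertwiner_inverse[OF G(1) \<rho>(1) \<sigma>(1)
            matrix_coefficient_sum_carrier _ matrix_coefficient_sum_intertwines[OF G \<rho>(2) \<sigma>(2) jk]])
    have "mat_trace (\<rho> g) = mat_trace (\<sigma> g)" if g: "g \<in> carrier G" for g
    proof -
      have r: "\<rho> g \<in> carrier_mat n n" and s: "\<sigma> g \<in> carrier_mat m m"
        using matrix_representation_carrier[OF G(1) \<rho>(2) g] matrix_representation_carrier[OF G(1) \<sigma>(2) g] .
      have T: "?T \<in> carrier_mat n m" by simp
      have "\<rho> g = (\<rho> g * ?T) * S"
        using assoc_mult_mat[OF r T S(1)] S r by simp
      also have "\<dots> = ?T * (\<sigma> g * S)"
        using matrix_coefficient_sum_intertwines[OF G \<rho>(2) \<sigma>(2) jk g] assoc_mult_mat[OF T s S(1)] by simp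
      finally have "mat_trace (\<rho> g) = mat_trace ((\<sigma> g * S) * ?T)"
        using mat_trace_mult_commute[OF T, of "\<sigma> g * S"] s S(1) by (metis mult_carrier_mat)
      then show ?thesis using assoc_mult_mat[OF s S(1) T] S s by simp
    qed
    then have "\<chi> = \<psi>" by (auto simp: \<rho> \<sigma> character_of_def)
    with ne show False by simp
  qed
  then show ?thesis
    unfolding \<rho>(3) \<sigma>(3) sum_characters_eq_sum_matrix_coefficients[OF G \<rho>(2) \<sigma>(2)] by simp
qed

text \<open>Each matrix coefficient sum is now a scalar matrix, and its trace determines the scalar:
  the group order divided by \<open>n\<close> for \<open>j = k\<close>, and zero otherwise.\<close>

theorem Irr_norm:
  fixes G (structure)
  assumes G: "group G" "finite (carrier G)" and \<chi>: "\<chi> \<in> Irr G"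
  shows "(\<Sum>g\<in>carrier G. \<chi> g * \<chi> (inv\<^bsub>G\<^esub> g)) = of_nat (card (carrier G))"
proof -
  interpret group G by fact
  obtain n \<rho> where \<rho>: "irreducible_representation G n \<rho>" "matrix_representation G n \<rho>" "n > 0"
      "\<chi> = character_of G \<rho>"
    using G(1) \<chi> by (elim IrrE)
  let ?N = "of_nat (card (carrier G)) :: complex"
  let ?T = "matrix_coefficient_sum G n \<rho> n \<rho>"
  note car = matrix_representation_carrier[OF G(1) \<rho>(2)]
  have T: "?T j k $$ (j, k) = (if j = k then ?N / of_nat n else 0)" if jk: "j < n" "k < n" for j k
  proof -
    obtain c where c: "?T j k = c \<cdot>\<^sub>m 1\<^sub>m n"
      by (rule irreducible_representation_commutant_scalar[OF G(1) \<rho>(1)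
            matrix_coefficient_sum_carrier matrix_coefficient_sum_intertwines[OF G \<rho>(2) \<rho>(2) jk]])
    \<comment> \<open>Both sides are the trace of the scalar matrix. Summing over \<open>i\<close>
      inside collects the entries into the \<open>(k, j)\<close> entry of
      \<open>\<rho> (inv g) * \<rho> g\<close>, which is the identity matrix.\<close>
    have "of_nat n * c = (\<Sum>i<n. ?T j k $$ (i, i))"
      unfolding c by simp
    also have "\<dots> = (\<Sum>i<n. \<Sum>g\<in>carrier G. \<rho> (inv g) $$ (k, i) * \<rho> g $$ (i, j))"
      by (simp add: matrix_coefficient_sum_def mult.commute)
    also have "\<dots> = (\<Sum>g\<in>carrier G. \<Sum>i<n. \<rho> (inv g) $$ (k, i) * \<rho> g $$ (i, j))"
      by (rule sum.swap)
    also have "\<dots> = (\<Sum>g\<in>carrier G. (\<rho> (inv g) * \<rho> g) $$ (k, j))"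
    proof (rule sum.cong[OF refl])
      fix g assume "g \<in> carrier G"
      then show "(\<Sum>i<n. \<rho> (inv g) $$ (k, i) * \<rho> g $$ (i, j)) = (\<rho> (inv g) * \<rho> g) $$ (k, j)"
        using car[of g] car[of "inv g"] jk by (simp add: scalar_prod_def atLeast0LessThan)
    qed
    also have "\<dots> = (\<Sum>g\<in>carrier G. 1\<^sub>m n $$ (k, j))"
      by (intro sum.cong refl)
        (simp flip: matrix_representation_mult[OF G(1) \<rho>(2)] add: matrix_representation_one[OF G(1) \<rho>(2)])
    finally have "of_nat n * c = (if j = k then ?N else 0)"
      using jk by auto
    then have "c = (if j = k then ?N / of_nat n else 0)"
      using \<rho>(3) by (auto simp: field_simps split: if_splits)
    then show ?thesis unfolding c using jk by simp
  qed
  have "(\<Sum>g\<in>carrier G. \<chi> g * \<chi> (inv g)) = (\<Sum>j<n. \<Sum>k<n. if j = k then ?N / of_nat n else 0)"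
    unfolding \<rho>(4) sum_characters_eq_sum_matrix_coefficients[OF G \<rho>(2) \<rho>(2)]
    using T by (intro sum.cong refl) auto
  also have "\<dots> = ?N"
    using \<rho>(3) by simp
  finally show ?thesis .
qed

section \<open>Finiteness of the set of irreducible characters\<close>

lemma character_of_outside: "g \<notin> carrier G \<Longrightarrow> character_of G \<rho> g = 0"
  by (simp add: character_of_def)

lemma sum_fun_apply: "(\<Sum>i\<in>I. f i) x = (\<Sum>i\<in>I. f i x)"
  by (induction I rule: infinite_finite_induct) auto

lemma vector_space_fun: "vector_space (\<lambda>(c :: 'b :: field) (f :: 'a \<Rightarrow> 'b) x. c * f x)"
  by unfold_locales (auto simp: fun_eq_iff algebra_simps)

text \<open>Characters vanish off the group, so they lie in the span of finitely many point masses,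
  while orthogonality makes the irreducible ones linearly independent.\<close>

lemma finite_Irr:
  assumes G: "group G" "finite (carrier G)"
  shows "finite (Irr G)"
proof -
  interpret V: vector_space "\<lambda>c (f :: 'a \<Rightarrow> complex) x. c * f x"
    by (rule vector_space_fun)
  define \<delta> where "\<delta> g = (\<lambda>x. if x = g then 1 else 0 :: complex)" for g :: 'a
  have "Irr G \<subseteq> V.span (\<delta> ` carrier G)"
  proof
    fix \<chi> assume "\<chi> \<in> Irr G"
    then have "\<chi> x = 0" if "x \<notin> carrier G" for x
      using that by (auto simp: Irr_def character_of_outside)
    then have "\<chi> = (\<Sum>g\<in>carrier G. (\<lambda>x. \<chi> g * \<delta> g x))"
      using G(2) by (auto simp: fun_eq_iff sum_fun_apply \<delta>_def if_distrib cong: if_cong)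
    also have "\<dots> \<in> V.span (\<delta> ` carrier G)"
      by (intro V.span_sum V.span_scale V.span_base) auto
    finally show "\<chi> \<in> V.span (\<delta> ` carrier G)" .
  qed
  moreover have "V.independent (Irr G)"
    unfolding V.independent_explicit_module
  proof (intro allI impI)
    fix F c \<psi> assume F: "finite F" "F \<subseteq> Irr G" and 0: "(\<Sum>\<chi>\<in>F. (\<lambda>x. c \<chi> * \<chi> x)) = 0" and \<psi>: "\<psi> \<in> F"
    \<comment> \<open>Pairing the linear relation with \<open>\<psi>\<close> isolates the
      coefficient of \<open>\<psi>\<close>.\<close>
    have "0 = (\<Sum>g\<in>carrier G. (\<Sum>\<chi>\<in>F. (\<lambda>x. c \<chi> * \<chi> x)) g * \<psi> (inv\<^bsub>G\<^esub> g))"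
      unfolding 0 by simp
    also have "\<dots> = (\<Sum>\<chi>\<in>F. c \<chi> * (\<Sum>g\<in>carrier G. \<chi> g * \<psi> (inv\<^bsub>G\<^esub> g)))"
      by (simp add: sum_fun_apply sum_distrib_left sum_distrib_right mult.assoc) (rule sum.swap)
    also have "\<dots> = (\<Sum>\<chi>\<in>F. if \<chi> = \<psi> then c \<chi> * of_nat (card (carrier G)) else 0)"
      using Irr_norm[OF G] Irr_orthogonal[OF G] F(2) \<psi> by (intro sum.cong refl) auto
    also have "\<dots> = c \<psi> * of_nat (card (carrier G))"
      using F(1) \<psi> by simp
    finally show "c \<psi> = 0"
      using G monoid.one_closed[OF group.is_monoid] by (auto simp: card_eq_0_iff)
  qed
  ultimately show ?thesis
    using V.independent_span_bound[of "\<delta> ` carrier G" "Irr G"] G(2) by blast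
qed

section \<open>The trivial character and products of irreducible characters\<close>

definition trivial_character :: "('a, 'm) monoid_scheme \<Rightarrow> 'a \<Rightarrow> complex" where
  "trivial_character G g = (if g \<in> carrier G then 1 else 0)"

lemma trivial_character_in_Irr:
  assumes "group G"
  shows "trivial_character G \<in> Irr G"
proof -
  interpret group G by fact
  define \<rho> where "\<rho> = (\<lambda>_ :: 'a. 1\<^sub>m 1 :: complex mat)"
  have "W = {0\<^sub>v 1} \<or> W = carrier_vec 1"
    if W: "VectorSpace.subspace class_ring W (module_vec TYPE(complex) 1)" for W
  proof -
    have sub: "W \<subseteq> carrier_vec 1" "0\<^sub>v 1 \<in> W" "\<And>c v. v \<in> W \<Longrightarrow> c \<cdot>\<^sub>v v \<in> W"
      using W unfolding VectorSpace.subspace_def submodule_def by (auto simp: module_vec_simps)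
    \<comment> \<open>In dimension one every vector is a multiple of any nonzero
      \<open>w\<close>.\<close>
    have "v \<in> W" if w: "w \<in> W" "w \<noteq> 0\<^sub>v 1" and v: "v \<in> carrier_vec 1" for v w
    proof -
      have "w \<in> carrier_vec 1" using w sub(1) by blast
      moreover from this w(2) have "w $ 0 \<noteq> 0" by (auto simp: vec_eq_iff)
      ultimately have "v = (v $ 0 / w $ 0) \<cdot>\<^sub>v w" using v by (intro eq_vecI) auto
      then show ?thesis using sub(3)[OF w(1)] by metis
    qed
    then show ?thesis using sub(1,2) by blast
  qed
  then have "irreducible_representation G 1 \<rho>"
    using matrix_representationI[OF assms, of \<rho> 1] by (auto simp: irreducible_representation_def \<rho>_def)
  moreover have "trivial_character G = character_of G \<rho>"
    by (auto simp: fun_eq_iff trivial_character_def character_of_def mat_trace_def \<rho>_def)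
  ultimately show ?thesis by (auto simp: Irr_def)
qed

text \<open>The sum of the values is the pairing with the trivial character, so the orthogonality
  relations evaluate it.\<close>

lemma sum_Irr:
  assumes G: "group G" "finite (carrier G)" and \<chi>: "\<chi> \<in> Irr G"
  shows "(\<Sum>g\<in>carrier G. \<chi> g) = (if \<chi> = trivial_character G then of_nat (card (carrier G)) else 0)"
proof -
  interpret group G by fact
  have "(\<Sum>g\<in>carrier G. \<chi> g) = (\<Sum>g\<in>carrier G. \<chi> g * trivial_character G (inv\<^bsub>G\<^esub> g))"
    by (intro sum.cong) (auto simp: trivial_character_def)
  then show ?thesis
    using Irr_norm[OF G \<chi>] Irr_orthogonal[OF G \<chi> trivial_character_in_Irr[OF G(1)]] by auto
qed

text \<open>Pairing the relation with \<open>\<chi>\<close> gives \<open>a\<close> times the group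
  order on the left and, if the characters differ, zero on the right.\<close>

lemma Irr_proportional_imp_eq:
  assumes G: "group G" "finite (carrier G)" and "\<chi> \<in> Irr G" "\<psi> \<in> Irr G"
    and "a \<noteq> 0" and eq: "\<And>g. g \<in> carrier G \<Longrightarrow> a * \<chi> g = b * \<psi> g"
  shows "\<chi> = \<psi>"
proof (rule ccontr)
  assume "\<chi> \<noteq> \<psi>"
  have "a * (\<Sum>g\<in>carrier G. \<chi> g * \<chi> (inv\<^bsub>G\<^esub> g)) = b * (\<Sum>g\<in>carrier G. \<psi> g * \<chi> (inv\<^bsub>G\<^esub> g))"
    using eq by (simp add: sum_distrib_left mult.assoc[symmetric])
  also have "\<dots> = 0" using Irr_orthogonal[OF G, of \<psi> \<chi>] assms \<open>\<chi> \<noteq> \<psi>\<close> by simp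
  finally show False
    using Irr_norm[OF G] assms monoid.one_closed[OF group.is_monoid[OF G(1)]]
    by (auto simp: card_eq_0_iff)
qed

text \<open>Setting one coordinate to the identity makes the characters in the other coordinate
  proportional, with a nonzero degree as the factor on the left.\<close>

lemma inj_on_char_prod_Irr:
  assumes G: "group G" "finite (carrier G)" and G': "group G'" "finite (carrier G')"
  shows "inj_on (\<lambda>(\<chi>, \<chi>'). char_prod \<chi> \<chi>') (Irr G \<times> Irr G')"
proof (rule inj_onI, clarify)
  fix \<chi> \<chi>' \<psi> \<psi>' assume Irr: "\<chi> \<in> Irr G" "\<chi>' \<in> Irr G'" "\<psi> \<in> Irr G" "\<psi>' \<in> Irr G'"
    and "char_prod \<chi> \<chi>' = char_prod \<psi> \<psi>'"
  then have eq: "\<chi> g * \<chi>' g' = \<psi> g * \<psi>' g'" for g g'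
    by (auto simp: char_prod_def fun_eq_iff)
  have "\<chi> \<one>\<^bsub>G\<^esub> \<noteq> 0" "\<chi>' \<one>\<^bsub>G'\<^esub> \<noteq> 0"
    using IrrE[OF G(1) Irr(1)] IrrE[OF G'(1) Irr(2)] by (metis less_irrefl of_nat_eq_0_iff)+
  then show "\<chi> = \<psi> \<and> \<chi>' = \<psi>'"
    using Irr_proportional_imp_eq[OF G Irr(1,3), of "\<chi>' \<one>\<^bsub>G'\<^esub>" "\<psi>' \<one>\<^bsub>G'\<^esub>"]
      Irr_proportional_imp_eq[OF G' Irr(2,4), of "\<chi> \<one>\<^bsub>G\<^esub>" "\<psi> \<one>\<^bsub>G\<^esub>"] eq
    by (auto simp: mult.commute)
qed

section \<open>Sums of induced linear characters\<close>

text \<open>The value 1 at the identity forces the dimension to be 1. Later arguments thus treat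
  linear characters as multiplicative functions extended by zero.\<close>

lemma linear_character_iff:
  assumes "group G"
  shows "linear_character G \<mu> \<longleftrightarrow> \<mu> \<one>\<^bsub>G\<^esub> = 1 \<and> (\<forall>g. g \<notin> carrier G \<longrightarrow> \<mu> g = 0) \<and>
    (\<forall>g \<in> carrier G. \<forall>h \<in> carrier G. \<mu> (g \<otimes>\<^bsub>G\<^esub> h) = \<mu> g * \<mu> h)"
    (is "_ \<longleftrightarrow> ?R")
proof
  assume \<mu>: "linear_character G \<mu>"
  then obtain n \<rho> where \<rho>: "matrix_representation G n \<rho>" "\<mu> = character_of G \<rho>"
    by (auto simp: linear_character_def is_character_def)
  moreover have "n = 1"
    using \<mu> character_of_one[OF assms \<rho>(1)] \<rho>(2) by (simp add: linear_character_def)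
  ultimately have \<rho>: "matrix_representation G 1 \<rho>" by simp
  have eq: "\<mu> g = \<rho> g $$ (0, 0)" if "g \<in> carrier G" for g
    using matrix_representation_carrier[OF assms \<rho> that] that
    by (simp add: \<open>\<mu> = _\<close> character_of_def mat_trace_def)
  have "\<mu> (g \<otimes>\<^bsub>G\<^esub> h) = \<mu> g * \<mu> h" if gh: "g \<in> carrier G" "h \<in> carrier G" for g h
    using matrix_representation_carrier[OF assms \<rho> gh(1)] matrix_representation_carrier[OF assms \<rho> gh(2)]
      gh monoid.m_closed[OF group.is_monoid[OF assms] gh]
    by (simp add: eq matrix_representation_mult[OF assms \<rho>] scalar_prod_def)
  then show ?R
    using \<mu> by (auto simp: \<open>\<mu> = _\<close> character_of_outside linear_character_def)
next
  assume \<mu>: ?R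
  define \<rho> where "\<rho> g = mat 1 1 (\<lambda>_. \<mu> g)" for g
  have "matrix_representation G 1 \<rho>"
    using \<mu> by (intro matrix_representationI[OF assms]) (auto simp: \<rho>_def scalar_prod_def)
  moreover have "\<mu> = character_of G \<rho>"
    using \<mu> by (auto simp: fun_eq_iff character_of_def mat_trace_def \<rho>_def)
  ultimately show "linear_character G \<mu>"
    using \<mu> by (auto simp: linear_character_def is_character_def)
qed

lemma linear_character_subgroup_iff:
  assumes "group G" "subgroup H G"
  shows "linear_character (G\<lparr>carrier := H\<rparr>) \<mu> \<longleftrightarrow> \<mu> \<one>\<^bsub>G\<^esub> = 1 \<and> (\<forall>g. g \<notin> H \<longrightarrow> \<mu> g = 0) \<and>
    (\<forall>g \<in> H. \<forall>h \<in> H. \<mu> (g \<otimes>\<^bsub>G\<^esub> h) = \<mu> g * \<mu> h)"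
  using linear_character_iff[OF subgroup.subgroup_is_group[OF assms(2,1)]] by simp

text \<open>Extension by zero absorbs the case distinction in \<open>induced\<close>.\<close>

lemma induced_eq:
  assumes "group G" "subgroup H G" "linear_character (G\<lparr>carrier := H\<rparr>) \<mu>" "g \<in> carrier G"
  shows "induced G H \<mu> g =
    (\<Sum>x\<in>carrier G. \<mu> (x \<otimes>\<^bsub>G\<^esub> g \<otimes>\<^bsub>G\<^esub> inv\<^bsub>G\<^esub> x)) / of_nat (card H)"
proof -
  have "(if k \<in> H then \<mu> k else 0) = \<mu> k" for k
    using assms(3) by (auto simp: linear_character_subgroup_iff[OF assms(1,2)])
  then show ?thesis using assms(4) by (simp add: induced_def)
qed

text \<open>Isolates the left-hand side of the condition in \<open>almost_monomial\<close>. The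
  choice \<open>t = 0\<close> admits the zero function, which deflation may produce.\<close>

definition is_monomial_sum :: "('a, 'm) monoid_scheme \<Rightarrow> ('a \<Rightarrow> complex) \<Rightarrow> bool" where
  "is_monomial_sum G \<phi> \<longleftrightarrow>
     (\<exists>(t :: nat) H \<mu>.
        (\<forall>i \<in> {1..t}. subgroup (H i) G \<and> linear_character (G\<lparr>carrier := H i\<rparr>) (\<mu> i)) \<and>
        (\<forall>g \<in> carrier G. (\<Sum>i = 1..t. induced G (H i) (\<mu> i) g) = \<phi> g))"

text \<open>Other finite index sets occur below: pairs of indices for products, and the surviving
  terms for deflation.\<close>

lemma is_monomial_sumI:
  assumes "finite I" and sub: "\<And>i. i \<in> I \<Longrightarrow> subgroup (H i) G"
    and lin: "\<And>i. i \<in> I \<Longrightarrow> linear_character (G\<lparr>carrier := H i\<rparr>) (\<mu> i)"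
    and eq: "\<And>g. g \<in> carrier G \<Longrightarrow> \<phi> g = (\<Sum>i\<in>I. induced G (H i) (\<mu> i) g)"
  shows "is_monomial_sum G \<phi>"
proof -
  obtain h where h: "bij_betw h {1..card I} I"
    using ex_bij_betw_nat_finite_1[OF assms(1)] by blast
  have "(\<Sum>i = 1..card I. induced G (H (h i)) (\<mu> (h i)) g) = \<phi> g" if "g \<in> carrier G" for g
    using sum.reindex_bij_betw[OF h, of "\<lambda>i. induced G (H i) (\<mu> i) g"] eq[OF that] by simp
  moreover have "h i \<in> I" if "i \<in> {1..card I}" for i
    using h that by (auto simp: bij_betw_def)
  ultimately show ?thesis
    unfolding is_monomial_sum_def using sub lin
    by (intro exI[of _ "card I"] exI[of _ "H \<circ> h"] exI[of _ "\<mu> \<circ> h"]) auto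
qed

lemma is_monomial_sumE:
  assumes "is_monomial_sum G \<phi>"
  obtains t :: nat and H \<mu> where "\<forall>i\<in>{1..t}. subgroup (H i) G"
    "\<forall>i\<in>{1..t}. linear_character (G\<lparr>carrier := H i\<rparr>) (\<mu> i)"
    "\<forall>g\<in>carrier G. \<phi> g = (\<Sum>i = 1..t. induced G (H i) (\<mu> i) g)"
proof -
  obtain t :: nat and H \<mu> where
    "\<forall>i \<in> {1..t}. subgroup (H i) G \<and> linear_character (G\<lparr>carrier := H i\<rparr>) (\<mu> i)"
    "\<forall>g \<in> carrier G. (\<Sum>i = 1..t. induced G (H i) (\<mu> i) g) = \<phi> g"
    using assms unfolding is_monomial_sum_def by blast
  then show thesis by (intro that[of t H \<mu>]) auto
qed

lemma almost_monomial_iff: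
  "almost_monomial G C \<longleftrightarrow>
     (\<forall>X \<in> fst C. \<forall>Y \<in> fst C. X \<noteq> Y \<longrightarrow>
        (\<exists>\<alpha> :: ('a \<Rightarrow> complex) set \<Rightarrow> int.
           is_monomial_sum G (\<lambda>g. \<Sum>Z \<in> fst C. of_int (\<alpha> Z) * supercharacter G Z g) \<and>
           (\<forall>Z \<in> fst C. \<alpha> Z \<ge> 0) \<and> \<alpha> X > 0 \<and> \<alpha> Y = 0))"
  for G :: "('a, 'm) monoid_scheme"
  unfolding almost_monomial_def is_monomial_sum_def
  by (intro ball_cong refl imp_cong) blast

text \<open>Take \<open>N\<close> copies of the trivial character, induced from the whole group to
  itself. This serves the case of the trivial group.\<close>

lemma is_monomial_sum_of_nat:
  assumes G: "group G" "finite (carrier G)"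
  shows "is_monomial_sum G (\<lambda>_. of_nat N)"
proof (rule is_monomial_sumI[where I = "{..<N}"])
  interpret group G by fact
  show sub: "subgroup (carrier G) G" by (rule subgroup_self)
  show lin: "linear_character (G\<lparr>carrier := carrier G\<rparr>) (trivial_character G)"
    unfolding linear_character_subgroup_iff[OF G(1) sub] by (auto simp: trivial_character_def)
  show "of_nat N = (\<Sum>i<N. induced G (carrier G) (trivial_character G) g)" if "g \<in> carrier G" for g
    using that G(2) by (auto simp: induced_eq[OF G(1) sub lin] trivial_character_def card_eq_0_iff)
qed auto

text \<open>Conjugation in the direct product acts coordinatewise, so the sum over conjugating pairs
  factors.\<close>

lemma induced_DirProd:
  assumes G: "group G" and G': "group G'" and g: "g \<in> carrier G" "g' \<in> carrier G'"
  shows "induced (G \<times>\<times> G') (H \<times> H') (char_prod \<mu> \<mu>') (g, g') = induced G H \<mu> g * induced G' H' \<mu>' g'"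
proof -
  have "(\<Sum>z\<in>carrier (G \<times>\<times> G'). let k = z \<otimes>\<^bsub>G \<times>\<times> G'\<^esub> (g, g') \<otimes>\<^bsub>G \<times>\<times> G'\<^esub> inv\<^bsub>G \<times>\<times> G'\<^esub> z in
        if k \<in> H \<times> H' then char_prod \<mu> \<mu>' k else 0) =
      (\<Sum>(x, x')\<in>carrier G \<times> carrier G'.
        (let k = x \<otimes>\<^bsub>G\<^esub> g \<otimes>\<^bsub>G\<^esub> inv\<^bsub>G\<^esub> x in if k \<in> H then \<mu> k else 0) *
        (let k = x' \<otimes>\<^bsub>G'\<^esub> g' \<otimes>\<^bsub>G'\<^esub> inv\<^bsub>G'\<^esub> x' in if k \<in> H' then \<mu>' k else 0))"
    by (rule sum.cong) (auto simp: inv_DirProd[OF G G'] char_prod_def Let_def)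
  then show ?thesis
    using g by (simp add: induced_def Let_def sum_product sum.cartesian_product card_cartesian_product)
qed

lemma is_monomial_sum_DirProd:
  assumes G: "group G" and G': "group G'"
    and \<phi>: "is_monomial_sum G \<phi>" and \<phi>': "is_monomial_sum G' \<phi>'"
  shows "is_monomial_sum (G \<times>\<times> G') (char_prod \<phi> \<phi>')"
proof -
  obtain t :: nat and H \<mu> where H: "\<forall>i\<in>{1..t}. subgroup (H i) G"
    "\<forall>i\<in>{1..t}. linear_character (G\<lparr>carrier := H i\<rparr>) (\<mu> i)"
    "\<forall>g\<in>carrier G. \<phi> g = (\<Sum>i = 1..t. induced G (H i) (\<mu> i) g)"
    using \<phi> by (rule is_monomial_sumE)
  note H = H[rule_format]
  obtain t' :: nat and H' \<mu>' where H': "\<forall>i\<in>{1..t'}. subgroup (H' i) G'"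
    "\<forall>i\<in>{1..t'}. linear_character (G'\<lparr>carrier := H' i\<rparr>) (\<mu>' i)"
    "\<forall>g\<in>carrier G'. \<phi>' g = (\<Sum>i = 1..t'. induced G' (H' i) (\<mu>' i) g)"
    using \<phi>' by (rule is_monomial_sumE)
  note H' = H'[rule_format]
  show ?thesis
  proof (rule is_monomial_sumI)
    show "finite ({1..t} \<times> {1..t'})" by simp
    show sub: "subgroup (H (fst i) \<times> H' (snd i)) (G \<times>\<times> G')" if "i \<in> {1..t} \<times> {1..t'}" for i
      using that by (intro DirProd_subgroups G G' H H') auto
    show "linear_character ((G \<times>\<times> G')\<lparr>carrier := H (fst i) \<times> H' (snd i)\<rparr>) (char_prod (\<mu> (fst i)) (\<mu>' (snd i)))"
      if i: "i \<in> {1..t} \<times> {1..t'}" for i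
    proof -
      have "linear_character (G\<lparr>carrier := H (fst i)\<rparr>) (\<mu> (fst i))"
        "linear_character (G'\<lparr>carrier := H' (snd i)\<rparr>) (\<mu>' (snd i))" 
        "subgroup (H (fst i)) G" "subgroup (H' (snd i)) G'"
        using H H' i by auto
      then show ?thesis
        unfolding linear_character_subgroup_iff[OF DirProd_group[OF G G'] sub[OF i]]
        by (simp add: linear_character_subgroup_iff[OF G] linear_character_subgroup_iff[OF G'])
          (auto simp: char_prod_def)
    qed
    show "char_prod \<phi> \<phi>' z =
        (\<Sum>i\<in>{1..t} \<times> {1..t'}. induced (G \<times>\<times> G') (H (fst i) \<times> H' (snd i)) (char_prod (\<mu> (fst i)) (\<mu>' (snd i))) z)"
      if "z \<in> carrier (G \<times>\<times> G')" for z
      using that by (cases z)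
        (simp add: char_prod_def[of \<phi>] H(3) H'(3) sum_product sum.cartesian_product
          induced_DirProd[OF G G'] case_prod_beta)
  qed
qed

section \<open>Deflation\<close>

text \<open>Every fibre over a point of the image is a translate of the kernel.\<close>

lemma (in group_hom) sum_comp_hom:
  assumes "finite (carrier G)"
  shows "(\<Sum>x\<in>carrier G. F (h x)) = of_nat (card (kernel G H h)) * (\<Sum>y\<in>h ` carrier G. F y :: 'e :: comm_semiring_1)"
proof -
  have fibre: "card {x \<in> carrier G. h x = h a} = card (kernel G H h)" if a: "a \<in> carrier G" for a
    using a by (intro bij_betw_same_card[of "\<lambda>x. inv a \<otimes> x"] bij_betw_byWitness[of _ "\<lambda>x. a \<otimes> x"])
      (auto simp: kernel_def G.m_assoc[symmetric])
  have "(\<Sum>x\<in>carrier G. F (h x)) = (\<Sum>y\<in>h ` carrier G. \<Sum>x\<in>{x \<in> carrier G. h x = y}. F (h x))"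
    by (rule sum.image_gen[OF assms])
  also have "\<dots> = (\<Sum>y\<in>h ` carrier G. of_nat (card (kernel G H h)) * F y)"
    using fibre by (intro sum.cong refl) auto
  finally show ?thesis by (simp add: sum_distrib_left)
qed

text \<open>Treats a single induced term; \<open>is_monomial_sum_deflation\<close> assembles the
  sums.\<close>

locale deflation = group_hom G H h
  for G :: "('a, 'm) monoid_scheme" (structure) and H :: "('b, 'n) monoid_scheme" (structure) and h +
  fixes S :: "'a set" and \<mu> :: "'a \<Rightarrow> complex"
  assumes finite_carrier: "finite (carrier G)"
    and surj: "h ` carrier G = carrier H"
    and S: "subgroup S G"
    and \<mu>: "linear_character (G\<lparr>carrier := S\<rparr>) \<mu>"
begin

text \<open>As \<open>\<mu>\<close> vanishes off \<open>S\<close>, only the part of the fibre inside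
  \<open>S\<close> contributes.\<close>

definition fibre_sum :: "'b \<Rightarrow> complex" where
  "fibre_sum k = (\<Sum>x | x \<in> carrier G \<and> h x = k. \<mu> x)"

text \<open>The kernel sum \<open>fibre_sum \<one>\<close> vanishes if and only if \<open>\<mu>\<close> is nontrivial on the intersection of \<open>S\<close>
  with the kernel; \<open>deflated\<close> is meaningful only if it does not vanish.\<close>

definition deflated :: "'b \<Rightarrow> complex" where
  "deflated k = fibre_sum k / fibre_sum \<one>\<^bsub>H\<^esub>"

lemma \<mu>_props: "\<mu> \<one> = 1" "g \<notin> S \<Longrightarrow> \<mu> g = 0" "g \<in> S \<Longrightarrow> k \<in> S \<Longrightarrow> \<mu> (g \<otimes> k) = \<mu> g * \<mu> k"
  using \<mu> by (auto simp: linear_character_subgroup_iff[OF G.is_group S])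

text \<open>For \<open>g\<close> outside \<open>S\<close> the product \<open>s \<otimes> g\<close>
  is outside as well, and both sides are zero.\<close>

lemma \<mu>_mult: "s \<in> S \<Longrightarrow> g \<in> carrier G \<Longrightarrow> \<mu> (s \<otimes> g) = \<mu> s * \<mu> g"
proof (cases "g \<in> S")
  case False
  assume "s \<in> S" "g \<in> carrier G"
  moreover have "s \<otimes> g \<notin> S"
  proof
    assume "s \<otimes> g \<in> S"
    then have "inv s \<otimes> (s \<otimes> g) \<in> S"
      by (rule subgroup.m_closed[OF S subgroup.m_inv_closed[OF S \<open>s \<in> S\<close>]])
    moreover have "inv s \<otimes> (s \<otimes> g) = g"
      using \<open>g \<in> carrier G\<close> subgroup.mem_carrier[OF S \<open>s \<in> S\<close>] by (simp add: G.m_assoc[symmetric])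
    ultimately show False using False by simp
  qed
  ultimately show ?thesis using False \<mu>_props by simp
qed (simp add: \<mu>_props)

text \<open>Left multiplication by \<open>s\<close> carries the kernel onto the fibre over
  \<open>h s\<close>.\<close>

lemma fibre_sum_image:
  assumes s: "s \<in> S"
  shows "fibre_sum (h s) = \<mu> s * fibre_sum \<one>\<^bsub>H\<^esub>"
proof -
  have sG: "s \<in> carrier G" using S s by (rule subgroup.mem_carrier)
  have "fibre_sum (h s) = (\<Sum>x | x \<in> carrier G \<and> h x = \<one>\<^bsub>H\<^esub>. \<mu> (s \<otimes> x))"
    unfolding fibre_sum_def using sG
    by (intro sum.reindex_bij_witness[of _ "\<lambda>x. s \<otimes> x" "\<lambda>x. inv s \<otimes> x"])
      (auto simp: G.m_assoc[symmetric])
  then show ?thesis using s by (simp add: \<mu>_mult sum_distrib_left fibre_sum_def)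
qed

lemma fibre_sum_outside: "k \<notin> h ` S \<Longrightarrow> fibre_sum k = 0"
  unfolding fibre_sum_def by (rule sum.neutral) (use \<mu>_props(2) in blast)

lemma subgroup_image: "subgroup (h ` S) H"
  by (rule subgroup_img_is_subgroup[OF S])

text \<open>Dividing by the kernel sum turns \<open>fibre_sum (h s)\<close> into
  \<open>\<mu> s\<close>. So \<open>\<mu>\<close> factors through \<open>h\<close> on
  \<open>S\<close>, and multiplicativity is inherited.\<close>

lemma linear_character_deflated:
  assumes "fibre_sum \<one>\<^bsub>H\<^esub> \<noteq> 0"
  shows "linear_character (H\<lparr>carrier := h ` S\<rparr>) deflated"
proof -
  have d: "deflated (h s) = \<mu> s" if "s \<in> S" for s
    using assms that by (simp add: deflated_def fibre_sum_image)
  have "deflated (h s \<otimes>\<^bsub>H\<^esub> h t) = deflated (h s) * deflated (h t)" if "s \<in> S" "t \<in> S" for s t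
    using that S d[of "s \<otimes> t"] by (simp add: d \<mu>_props subgroup.m_closed subgroup.mem_carrier)
  then show ?thesis
    using assms by (auto simp: linear_character_subgroup_iff[OF H.is_group subgroup_image] deflated_def
        fibre_sum_outside)
qed

text \<open>A nonzero kernel sum forces \<open>\<mu>\<close> to be 1 on the kernel of
  \<open>h\<close> restricted to \<open>S\<close>. The sum then counts this kernel, and the order of
  \<open>S\<close> is the order of the kernel times that of the image.\<close>

lemma card_eq_fibre_sum:
  assumes "fibre_sum \<one>\<^bsub>H\<^esub> \<noteq> 0"
  shows "of_nat (card S) = fibre_sum \<one>\<^bsub>H\<^esub> * of_nat (card (h ` S))"
proof -
  have SG: "S \<subseteq> carrier G" using S by (rule subgroup.subset)
  interpret S: group_hom "G\<lparr>carrier := S\<rparr>" H h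
    using subgroup.subgroup_is_group[OF S G.is_group] homh subsetD[OF SG]
    by (intro group_hom.intro group_hom_axioms.intro H.is_group) (auto simp: hom_def)
  \<comment> \<open>For \<open>s\<close> in the kernel, \<open>fibre_sum_image\<close> says that the
    kernel sum is \<open>\<mu> s\<close> times itself; cancel it.\<close>
  have 1: "\<mu> s = 1" if "s \<in> S" "h s = \<one>\<^bsub>H\<^esub>" for s
    using fibre_sum_image[OF that(1)] that(2) assms by simp
  have "fibre_sum \<one>\<^bsub>H\<^esub> = (\<Sum>x | x \<in> S \<and> h x = \<one>\<^bsub>H\<^esub>. 1)"
    unfolding fibre_sum_def using SG 1 \<mu>_props(2) finite_carrier
    by (intro sum.mono_neutral_cong_right) auto
  then have "fibre_sum \<one>\<^bsub>H\<^esub> = of_nat (card (kernel (G\<lparr>carrier := S\<rparr>) H h))"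
    by (simp add: kernel_def)
  then show ?thesis
    using S.sum_comp_hom[of "\<lambda>_. 1 :: complex"] finite_subset[OF SG finite_carrier] by simp
qed

text \<open>After exchanging the sums, conjugation by \<open>y\<close> carries the fibre over
  \<open>k\<close> to the fibre over the conjugate of \<open>k\<close> by \<open>h y\<close>. The
  inner sum depends only on \<open>h y\<close>, so the sum over \<open>y\<close> descends to
  \<open>H\<close> at the cost of the kernel order.\<close>

lemma sum_fibre_induced:
  assumes k: "k \<in> carrier H"
  shows "(\<Sum>x | x \<in> carrier G \<and> h x = k. induced G S \<mu> x) =
    (if fibre_sum \<one>\<^bsub>H\<^esub> = 0 then 0 else of_nat (card (kernel G H h)) * induced H (h ` S) deflated k)"
proof -
  have "(\<Sum>x | x \<in> carrier G \<and> h x = k. induced G S \<mu> x) =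
      (\<Sum>x | x \<in> carrier G \<and> h x = k. \<Sum>y\<in>carrier G. \<mu> (y \<otimes> x \<otimes> inv y)) / of_nat (card S)"
    by (simp add: induced_eq[OF G.is_group S \<mu>] sum_divide_distrib)
  also have "(\<Sum>x | x \<in> carrier G \<and> h x = k. \<Sum>y\<in>carrier G. \<mu> (y \<otimes> x \<otimes> inv y)) =
      (\<Sum>y\<in>carrier G. \<Sum>x | x \<in> carrier G \<and> h x = k. \<mu> (y \<otimes> x \<otimes> inv y))"
    by (rule sum.swap)
  also have "\<dots> = (\<Sum>y\<in>carrier G. fibre_sum (h y \<otimes>\<^bsub>H\<^esub> k \<otimes>\<^bsub>H\<^esub> inv\<^bsub>H\<^esub> h y))"
  proof (rule sum.cong[OF refl])
    fix y assume y: "y \<in> carrier G"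
    have [simp]: "inv y \<otimes> (y \<otimes> x) = x" "y \<otimes> (inv y \<otimes> x) = x" if "x \<in> carrier G" for x
      using y that by (simp_all add: G.m_assoc[symmetric])
    have [simp]: "inv\<^bsub>H\<^esub> h y \<otimes>\<^bsub>H\<^esub> (h y \<otimes>\<^bsub>H\<^esub> l) = l" if "l \<in> carrier H" for l
      using y that by (simp add: H.m_assoc[symmetric])
    show "(\<Sum>x | x \<in> carrier G \<and> h x = k. \<mu> (y \<otimes> x \<otimes> inv y)) =
        fibre_sum (h y \<otimes>\<^bsub>H\<^esub> k \<otimes>\<^bsub>H\<^esub> inv\<^bsub>H\<^esub> h y)"
      unfolding fibre_sum_def using y k
      by (intro sum.reindex_bij_witness[of _ "\<lambda>x. inv y \<otimes> x \<otimes> y" "\<lambda>x. y \<otimes> x \<otimes> inv y"])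
        (auto simp: G.m_assoc H.m_assoc)
  qed
  also have "\<dots> = of_nat (card (kernel G H h)) *
      (\<Sum>y\<in>carrier H. fibre_sum (y \<otimes>\<^bsub>H\<^esub> k \<otimes>\<^bsub>H\<^esub> inv\<^bsub>H\<^esub> y))"
    using sum_comp_hom[OF finite_carrier, of "\<lambda>y. fibre_sum (y \<otimes>\<^bsub>H\<^esub> k \<otimes>\<^bsub>H\<^esub> inv\<^bsub>H\<^esub> y)"] surj by simp
  finally have eq: "(\<Sum>x | x \<in> carrier G \<and> h x = k. induced G S \<mu> x) =
      of_nat (card (kernel G H h)) * (\<Sum>y\<in>carrier H. fibre_sum (y \<otimes>\<^bsub>H\<^esub> k \<otimes>\<^bsub>H\<^esub> inv\<^bsub>H\<^esub> y)) / of_nat (card S)" .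
  show ?thesis
  proof (cases "fibre_sum \<one>\<^bsub>H\<^esub> = 0")
    case True
    \<comment> \<open>Each fibre sum is a multiple of the kernel sum or lies over a point outside
      the image of \<open>S\<close>.\<close>
    then have "fibre_sum l = 0" for l
      using fibre_sum_image fibre_sum_outside by (cases "l \<in> h ` S") auto
    then show ?thesis using True eq by simp
  next
    case False
    \<comment> \<open>The extra factor in the order of \<open>S\<close> is exactly the denominator
      in \<open>deflated\<close>.\<close>
    then show ?thesis
      unfolding eq card_eq_fibre_sum[OF False]
      using induced_eq[OF H.is_group subgroup_image linear_character_deflated[OF False] k]
      by (simp add: deflated_def sum_divide_distrib[symmetric])
  qed
qed

end

text \<open>Deflate term by term; dividing by the kernel order cancels the factor in
  \<open>sum_fibre_induced\<close>.\<close>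

lemma (in group_hom) is_monomial_sum_deflation:
  assumes "finite (carrier G)" "h ` carrier G = carrier H" and \<phi>: "is_monomial_sum G \<phi>"
  shows "is_monomial_sum H (\<lambda>k. (\<Sum>x | x \<in> carrier G \<and> h x = k. \<phi> x) / of_nat (card (kernel G H h)))"
proof -
  obtain t :: nat and S \<mu> where S: "\<forall>i\<in>{1..t}. subgroup (S i) G"
    "\<forall>i\<in>{1..t}. linear_character (G\<lparr>carrier := S i\<rparr>) (\<mu> i)"
    "\<forall>g\<in>carrier G. \<phi> g = (\<Sum>i = 1..t. induced G (S i) (\<mu> i) g)"
    using \<phi> by (rule is_monomial_sumE)
  note S = S[rule_format]
  have D: "deflation G H h (S i) (\<mu> i)" if "i \<in> {1..t}" for i
    using S(1)[OF that] S(2)[OF that] assms(1,2) by (intro deflation.intro deflation_axioms.intro group_hom_axioms)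
  define f where "f i = deflation.fibre_sum G h (\<mu> i)" for i
  define d where "d i = deflation.deflated G H h (\<mu> i)" for i
  \<comment> \<open>Terms with vanishing kernel sum deflate to zero and are dropped, since
    \<open>deflated\<close> is no linear character for them.\<close>
  define I where "I = {i \<in> {1..t}. f i \<one>\<^bsub>H\<^esub> \<noteq> 0}"
  have ker: "of_nat (card (kernel G H h)) \<noteq> (0 :: complex)"
    using assms(1) by (auto simp: kernel_def card_eq_0_iff intro!: exI[of _ "\<one>"])
  show ?thesis
  proof (rule is_monomial_sumI)
    show "finite I" by (simp add: I_def)
    show "subgroup (h ` S i) H" if "i \<in> I" for i
      using deflation.subgroup_image[OF D] that by (simp add: I_def)
    show "linear_character (H\<lparr>carrier := h ` S i\<rparr>) (d i)" if "i \<in> I" for i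
      using deflation.linear_character_deflated[OF D] that by (simp add: I_def f_def d_def)
    show "(\<Sum>x | x \<in> carrier G \<and> h x = k. \<phi> x) / of_nat (card (kernel G H h)) =
        (\<Sum>i\<in>I. induced H (h ` S i) (d i) k)" if k: "k \<in> carrier H" for k
    proof -
      have "(\<Sum>x | x \<in> carrier G \<and> h x = k. \<phi> x) =
          (\<Sum>i = 1..t. \<Sum>x | x \<in> carrier G \<and> h x = k. induced G (S i) (\<mu> i) x)"
        by (simp add: S(3)) (rule sum.swap)
      also have "\<dots> = (\<Sum>i = 1..t. if f i \<one>\<^bsub>H\<^esub> = 0 then 0
          else of_nat (card (kernel G H h)) * induced H (h ` S i) (d i) k)"
        unfolding f_def d_def by (intro sum.cong refl deflation.sum_fibre_induced[OF D k])
      also have "\<dots> = (\<Sum>i\<in>I. of_nat (card (kernel G H h)) * induced H (h ` S i) (d i) k)"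
        unfolding I_def by (intro sum.mono_neutral_cong_right) auto
      finally show ?thesis using ker by (simp add: sum_distrib_left[symmetric])
    qed
  qed
qed

section \<open>Averaging over one factor of a direct product\<close>

lemma is_monomial_sum_cong:
  assumes "is_monomial_sum G \<phi>" "\<And>g. g \<in> carrier G \<Longrightarrow> \<phi> g = \<psi> g"
  shows "is_monomial_sum G \<psi>"
  using assms unfolding is_monomial_sum_def by fastforce

text \<open>This is deflation along the projection \<open>fst\<close>, whose fibres are copies of
  \<open>carrier G'\<close>.\<close>

lemma is_monomial_sum_average_snd:
  assumes G: "group G" "finite (carrier G)" and G': "group G'" "finite (carrier G')"
    and \<phi>: "is_monomial_sum (G \<times>\<times> G') \<phi>"
  shows "is_monomial_sum G (\<lambda>g. (\<Sum>g'\<in>carrier G'. \<phi> (g, g')) / of_nat (card (carrier G')))"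
proof -
  interpret group_hom "G \<times>\<times> G'" G fst
    using DirProd_group[OF G(1) G'(1)] G(1)
    by (auto simp: group_hom_def group_hom_axioms_def hom_def)
  have one: "\<one>\<^bsub>G\<^esub> \<in> carrier G" "\<one>\<^bsub>G'\<^esub> \<in> carrier G'"
    using G(1) G'(1) by (auto intro: group.is_monoid monoid.one_closed)
  have "kernel (G \<times>\<times> G') G fst = {\<one>\<^bsub>G\<^esub>} \<times> carrier G'"
    using one by (auto simp: kernel_def)
  then have "card (kernel (G \<times>\<times> G') G fst) = card (carrier G')"
    by (simp add: card_cartesian_product_singleton)
  moreover have "(\<Sum>x | x \<in> carrier (G \<times>\<times> G') \<and> fst x = g. \<phi> x) = (\<Sum>g'\<in>carrier G'. \<phi> (g, g'))"
    if "g \<in> carrier G" for g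
    using that by (intro sum.reindex_bij_witness[of _ "\<lambda>g'. (g, g')" snd]) auto
  moreover have "fst ` carrier (G \<times>\<times> G') = carrier G"
    using one by (auto simp: fst_image_times)
  ultimately show ?thesis
    using is_monomial_sum_deflation[OF _ _ \<phi>] G(2) G'(2) by (fastforce elim: is_monomial_sum_cong)
qed

lemma is_monomial_sum_average_fst:
  assumes G: "group G" "finite (carrier G)" and G': "group G'" "finite (carrier G')"
    and \<phi>: "is_monomial_sum (G \<times>\<times> G') \<phi>"
  shows "is_monomial_sum G' (\<lambda>g'. (\<Sum>g\<in>carrier G. \<phi> (g, g')) / of_nat (card (carrier G)))"
proof -
  interpret group_hom "G \<times>\<times> G'" G' snd
    using DirProd_group[OF G(1) G'(1)] G'(1)
    by (auto simp: group_hom_def group_hom_axioms_def hom_def)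
  have one: "\<one>\<^bsub>G\<^esub> \<in> carrier G" "\<one>\<^bsub>G'\<^esub> \<in> carrier G'"
    using G(1) G'(1) by (auto intro: group.is_monoid monoid.one_closed)
  have "kernel (G \<times>\<times> G') G' snd = carrier G \<times> {\<one>\<^bsub>G'\<^esub>}"
    using one by (auto simp: kernel_def)
  then have "card (kernel (G \<times>\<times> G') G' snd) = card (carrier G)"
    by (simp add: card_cartesian_product)
  moreover have "(\<Sum>x | x \<in> carrier (G \<times>\<times> G') \<and> snd x = g'. \<phi> x) = (\<Sum>g\<in>carrier G. \<phi> (g, g'))"
    if "g' \<in> carrier G'" for g'
    using that by (intro sum.reindex_bij_witness[of _ "\<lambda>g. (g, g')" fst]) auto
  moreover have "snd ` carrier (G \<times>\<times> G') = carrier G'"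
    using one by (auto simp: snd_image_times)
  ultimately show ?thesis
    using is_monomial_sum_deflation[OF _ _ \<phi>] G(2) G'(2) by (fastforce elim: is_monomial_sum_cong)
qed

section \<open>Products of supercharacter theories\<close>

lemma almost_monomialE:
  fixes G :: "('a, 'm) monoid_scheme"
  assumes "almost_monomial G C" "X \<in> fst C" "Y \<in> fst C" "X \<noteq> Y"
  obtains \<alpha> :: "('a \<Rightarrow> complex) set \<Rightarrow> int" where
    "is_monomial_sum G (\<lambda>g. \<Sum>Z\<in>fst C. of_int (\<alpha> Z) * supercharacter G Z g)"
    "\<forall>Z\<in>fst C. \<alpha> Z \<ge> 0" "\<alpha> X > 0" "\<alpha> Y = 0"
  using assms(1)[unfolded almost_monomial_iff, rule_format, OF assms(2-4)] by blast

locale finite_group_sct = group G for G :: "('a, 'm) monoid_scheme" (structure) +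
  fixes C :: "'a sct"
  assumes finite_carrier: "finite (carrier G)"
    and sct: "supercharacter_theory G C"
begin

lemma partition_Irr: "partition_on (Irr G) (fst C)"
  using sct by (simp add: supercharacter_theory_def)

lemma finite_parts: "finite (fst C)"
  using finite_elements[OF finite_Irr[OF group_axioms finite_carrier] partition_Irr] .

lemma part_props:
  assumes "X \<in> fst C"
  shows "X \<subseteq> Irr G" "X \<noteq> {}" "finite X"
proof -
  show "X \<subseteq> Irr G" "X \<noteq> {}" using partition_Irr assms by (auto simp: partition_on_def)
  then show "finite X" using finite_Irr[OF group_axioms finite_carrier] finite_subset by blast
qed

text \<open>Only the trivial character has a nonzero sum of values, and its degree factor is
  1.\<close>

lemma sum_supercharacter:
  assumes "X \<in> fst C"
  shows "(\<Sum>g\<in>carrier G. supercharacter G X g) =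
    (if trivial_character G \<in> X then of_nat (card (carrier G)) else 0)"
proof -
  have "(\<Sum>g\<in>carrier G. supercharacter G X g) = (\<Sum>\<chi>\<in>X. \<chi> \<one> * (\<Sum>g\<in>carrier G. \<chi> g))"
    unfolding supercharacter_def by (subst sum.swap) (simp add: sum_distrib_left)
  also have "\<dots> = (\<Sum>\<chi>\<in>X. if \<chi> = trivial_character G then of_nat (card (carrier G)) else 0)"
    using part_props[OF assms] sum_Irr[OF group_axioms finite_carrier]
    by (intro sum.cong refl) (auto simp: trivial_character_def)
  finally show ?thesis using part_props[OF assms] by simp
qed

lemma trivial_part: "\<exists>!T. T \<in> fst C \<and> trivial_character G \<in> T"
  using partition_Irr trivial_character_in_Irr[OF group_axioms]
  unfolding partition_on_def disjoint_def by blast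

lemma supercharacter_one_nat: "X \<in> fst C \<Longrightarrow> \<exists>N. supercharacter G X \<one> = of_nat N"
proof -
  assume X: "X \<in> fst C"
  have "\<exists>d. \<chi> \<one> = of_nat d" if "\<chi> \<in> X" for \<chi>
    using IrrE[OF group_axioms, of \<chi>] part_props(1)[OF X] that by blast
  then obtain d where "\<And>\<chi>. \<chi> \<in> X \<Longrightarrow> \<chi> \<one> = of_nat (d \<chi>)" by metis
  then have "supercharacter G X \<one> = of_nat (\<Sum>\<chi>\<in>X. d \<chi> * d \<chi>)"
    by (simp add: supercharacter_def)
  then show ?thesis by blast
qed

text \<open>Serves the coordinate in which the two parts to be separated may agree. Any second part
  provides the coefficients; if there is none, almost monomiality says nothing and a direct argument
  is required.\<close>

lemma positive_coefficient:
  assumes "almost_monomial G C" and X: "X \<in> fst C"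
  obtains \<alpha> :: "('a \<Rightarrow> complex) set \<Rightarrow> int" where
    "is_monomial_sum G (\<lambda>g. \<Sum>Z\<in>fst C. of_int (\<alpha> Z) * supercharacter G Z g)"
    "\<forall>Z\<in>fst C. \<alpha> Z \<ge> 0" "\<alpha> X > 0"
proof (cases "fst C = {X}")
  case False
  with X obtain Y where "Y \<in> fst C" "X \<noteq> Y" by blast
  then show thesis using almost_monomialE[OF assms] that by blast
next
  case True
  \<comment> \<open>A single part forces a single superclass, so the group is trivial.\<close>
  have "card (snd C) = 1" "{\<one>} \<in> snd C" "partition_on (carrier G) (snd C)"
    using sct True by (auto simp: supercharacter_theory_def)
  then have "carrier G = {\<one>}"
    by (auto simp: partition_on_def card_1_singleton_iff)
  \<comment> \<open>On the trivial group the supercharacter is determined by its value at the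
    identity, a natural number.\<close>
  moreover obtain N where "supercharacter G X \<one> = of_nat N"
    using supercharacter_one_nat[OF X] by blast
  ultimately have "is_monomial_sum G (supercharacter G X)"
    using is_monomial_sum_of_nat[OF group_axioms finite_carrier, of N] by (auto elim: is_monomial_sum_cong)
  then show thesis using True by (intro that[of "\<lambda>_. 1"]) simp_all
qed

end

section \<open>Parts of the product theory\<close>

definition part_prod :: "('a \<Rightarrow> complex) set \<Rightarrow> ('b \<Rightarrow> complex) set \<Rightarrow> ('a \<times> 'b \<Rightarrow> complex) set" where
  "part_prod X X' = (\<lambda>(\<chi>, \<chi>'). char_prod \<chi> \<chi>') ` (X \<times> X')"

text \<open>The form as an image allows sums over the parts to be reindexed by pairs.\<close>

lemma fst_product_theory:
  fixes C :: "'a sct" and C' :: "'b sct"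
  shows "fst (product_theory C C') = (\<lambda>(X, X'). part_prod X X') ` (fst C \<times> fst C')"
proof -
  have *: "part_prod X X' = {char_prod \<chi> \<chi>' | \<chi> \<chi>'. \<chi> \<in> X \<and> \<chi>' \<in> X'}"
    for X :: "('a \<Rightarrow> complex) set" and X' :: "('b \<Rightarrow> complex) set"
    by (auto simp: part_prod_def)
  then show ?thesis unfolding product_theory_def fst_conv *[symmetric] by auto
qed

locale finite_group_sct_pair = G: finite_group_sct G C + G': finite_group_sct G' C'
  for G :: "('a, 'm) monoid_scheme" and C and G' :: "('b, 'n) monoid_scheme" and C'
begin

text \<open>Coefficients are indexed by pairs of parts instead of product parts, so that fixing one
  part means fixing one argument of \<open>\<beta>\<close>.\<close>

abbreviation combination :: "(('a \<Rightarrow> complex) set \<Rightarrow> ('b \<Rightarrow> complex) set \<Rightarrow> int) \<Rightarrow> 'a \<times> 'b \<Rightarrow> complex" where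
  "combination \<beta> \<equiv> \<lambda>(g, g'). \<Sum>Z\<in>fst C. \<Sum>Z'\<in>fst C'.
     of_int (\<beta> Z Z') * (supercharacter G Z g * supercharacter G' Z' g')"

lemmas inj_char_prod = inj_on_char_prod_Irr[OF G.group_axioms G.finite_carrier G'.group_axioms G'.finite_carrier]

text \<open>Each character in the product part comes from exactly one pair, and degrees multiply, so
  the sum factors.\<close>

lemma supercharacter_part_prod:
  assumes "X \<in> fst C" "X' \<in> fst C'"
  shows "supercharacter (G \<times>\<times> G') (part_prod X X') (g, g') = supercharacter G X g * supercharacter G' X' g'"
proof -
  have "inj_on (\<lambda>(\<chi>, \<chi>'). char_prod \<chi> \<chi>') (X \<times> X')"
    using inj_char_prod G.part_props(1)[OF assms(1)] G'.part_props(1)[OF assms(2)]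
    by (blast intro: inj_on_subset)
  then show ?thesis
    unfolding supercharacter_def part_prod_def sum.reindex[OF \<open>inj_on _ _\<close>]
    by (simp add: sum_product sum.cartesian_product case_prod_beta char_prod_def mult_ac)
qed

text \<open>Injectivity of \<open>char_prod\<close> on irreducible characters gives equal sets of
  pairs, and the factors can be read off because parts are nonempty.\<close>

lemma inj_on_part_prod: "inj_on (\<lambda>(X, X'). part_prod X X') (fst C \<times> fst C')"
proof (rule inj_onI, clarify)
  fix X X' Y Y' assume parts: "X \<in> fst C" "X' \<in> fst C'" "Y \<in> fst C" "Y' \<in> fst C'"
    and "part_prod X X' = part_prod Y Y'"
  then have "(\<lambda>(\<chi>, \<chi>'). char_prod \<chi> \<chi>') ` (X \<times> X') = (\<lambda>(\<chi>, \<chi>'). char_prod \<chi> \<chi>') ` (Y \<times> Y')"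
    by (simp only: part_prod_def)
  then have "X \<times> X' = Y \<times> Y'"
    using inj_char_prod G.part_props(1) G'.part_props(1) parts
    by (subst (asm) inj_on_image_eq_iff) (auto dest: subsetD)
  then show "X = Y \<and> X' = Y'"
    using G.part_props(2) G'.part_props(2) parts by (auto simp: times_eq_iff)
qed

lemma sum_product_theory:
  "(\<Sum>Z\<in>fst (product_theory C C'). of_int (\<alpha> Z) * supercharacter (G \<times>\<times> G') Z x) =
    combination (\<lambda>Z Z'. \<alpha> (part_prod Z Z')) x"
  unfolding fst_product_theory sum.reindex[OF inj_on_part_prod]
  by (cases x) (simp add: sum.cartesian_product case_prod_beta, intro sum.cong refl,
      auto simp: supercharacter_part_prod)

text \<open>By injectivity, distinct pairs correspond to distinct product parts, and coefficients
  can be transported in both directions.\<close>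

lemma almost_monomial_product_iff:
  "almost_monomial (G \<times>\<times> G') (product_theory C C') \<longleftrightarrow>
    (\<forall>X\<in>fst C. \<forall>X'\<in>fst C'. \<forall>Y\<in>fst C. \<forall>Y'\<in>fst C'. (X, X') \<noteq> (Y, Y') \<longrightarrow>
      (\<exists>\<beta>. is_monomial_sum (G \<times>\<times> G') (combination \<beta>) \<and>
        (\<forall>Z\<in>fst C. \<forall>Z'\<in>fst C'. \<beta> Z Z' \<ge> 0) \<and> \<beta> X X' > 0 \<and> \<beta> Y Y' = 0))"
    (is "?L \<longleftrightarrow> ?R")
proof
  assume L: ?L
  show ?R
  proof (intro ballI impI)
    fix X X' Y Y' assume parts: "X \<in> fst C" "X' \<in> fst C'" "Y \<in> fst C" "Y' \<in> fst C'"
      and "(X, X') \<noteq> (Y, Y')"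
    then have ne: "part_prod X X' \<noteq> part_prod Y Y'"
      using inj_onD[OF inj_on_part_prod, of "(X, X')" "(Y, Y')"] by auto
    have mem: "part_prod Z Z' \<in> fst (product_theory C C')" if "Z \<in> fst C" "Z' \<in> fst C'" for Z Z'
      using that unfolding fst_product_theory by auto
    obtain \<alpha> :: "('a \<times> 'b \<Rightarrow> complex) set \<Rightarrow> int" where
      "is_monomial_sum (G \<times>\<times> G') (combination (\<lambda>Z Z'. \<alpha> (part_prod Z Z')))"
      "\<forall>Z\<in>fst (product_theory C C'). \<alpha> Z \<ge> 0" "\<alpha> (part_prod X X') > 0" "\<alpha> (part_prod Y Y') = 0"
      using L[unfolded almost_monomial_iff sum_product_theory, rule_format, OF mem mem ne] parts by blast
    then show "\<exists>\<beta>. is_monomial_sum (G \<times>\<times> G') (combination \<beta>) \<and>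
        (\<forall>Z\<in>fst C. \<forall>Z'\<in>fst C'. \<beta> Z Z' \<ge> 0) \<and> \<beta> X X' > 0 \<and> \<beta> Y Y' = 0"
      using mem by (intro exI[of _ "\<lambda>Z Z'. \<alpha> (part_prod Z Z')"]) auto
  qed
next
  assume R: ?R
  show ?L
    unfolding almost_monomial_iff sum_product_theory
  proof (intro ballI impI)
    fix V W assume VW: "V \<in> fst (product_theory C C')" "W \<in> fst (product_theory C C')" "V \<noteq> W"
    obtain X X' where X: "X \<in> fst C" "X' \<in> fst C'" "V = part_prod X X'"
      using VW(1) unfolding fst_product_theory by auto
    obtain Y Y' where Y: "Y \<in> fst C" "Y' \<in> fst C'" "W = part_prod Y Y'"
      using VW(2) unfolding fst_product_theory by auto
    have "(X, X') \<noteq> (Y, Y')" using VW(3) X(3) Y(3) by auto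
    then obtain \<beta> where \<beta>: "is_monomial_sum (G \<times>\<times> G') (combination \<beta>)"
      "\<forall>Z\<in>fst C. \<forall>Z'\<in>fst C'. \<beta> Z Z' \<ge> 0" "\<beta> X X' > 0" "\<beta> Y Y' = 0"
      using R X Y by blast
    \<comment> \<open>The inverse of the injection recovers the pair of parts from a product
      part.\<close>
    define \<alpha> where "\<alpha> = case_prod \<beta> \<circ> inv_into (fst C \<times> fst C') (\<lambda>(X, X'). part_prod X X')"
    have \<alpha>: "\<alpha> (part_prod Z Z') = \<beta> Z Z'" if "Z \<in> fst C" "Z' \<in> fst C'" for Z Z'
      using inv_into_f_f[OF inj_on_part_prod, of "(Z, Z')"] that by (simp add: \<alpha>_def)
    have "combination (\<lambda>Z Z'. \<alpha> (part_prod Z Z')) = combination \<beta>"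
      using \<alpha> by (auto simp: fun_eq_iff)
    moreover have "\<forall>Z\<in>fst (product_theory C C'). \<alpha> Z \<ge> 0"
      using \<alpha> \<beta>(2) unfolding fst_product_theory by auto
    ultimately show "\<exists>\<alpha>. is_monomial_sum (G \<times>\<times> G') (combination (\<lambda>Z Z'. \<alpha> (part_prod Z Z'))) \<and>
        (\<forall>Z\<in>fst (product_theory C C'). \<alpha> Z \<ge> (0 :: int)) \<and> \<alpha> V > 0 \<and> \<alpha> W = 0"
      using \<alpha> \<beta> X Y by (intro exI[of _ \<alpha>]) simp
  qed
qed

section \<open>The two implications\<close>

lemma combination_prod:
  assumes "is_monomial_sum G (\<lambda>g. \<Sum>Z\<in>fst C. of_int (\<alpha> Z) * supercharacter G Z g)"
    and "is_monomial_sum G' (\<lambda>g. \<Sum>Z\<in>fst C'. of_int (\<alpha>' Z) * supercharacter G' Z g)"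
  shows "is_monomial_sum (G \<times>\<times> G') (combination (\<lambda>Z Z'. \<alpha> Z * \<alpha>' Z'))"
  using is_monomial_sum_DirProd[OF G.group_axioms G'.group_axioms assms]
  by (rule is_monomial_sum_cong) (auto simp: char_prod_def sum_product mult_ac)

text \<open>The coefficients are the products \<open>\<alpha> Z * \<alpha>' Z'\<close>. Positivity
  at \<open>(X, X')\<close> needs both factors, but vanishing at \<open>(Y, Y')\<close> needs only
  one, so it suffices to separate in a coordinate where the pairs differ.\<close>

lemma almost_monomial_product:
  assumes G: "almost_monomial G C" and G': "almost_monomial G' C'"
  shows "almost_monomial (G \<times>\<times> G') (product_theory C C')"
  unfolding almost_monomial_product_iff
proof (intro ballI impI)
  fix X X' Y Y' assume parts: "X \<in> fst C" "X' \<in> fst C'" "Y \<in> fst C" "Y' \<in> fst C'"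
    and "(X, X') \<noteq> (Y, Y')"
  then consider "X \<noteq> Y" | "X' \<noteq> Y'" by auto
  then obtain \<alpha> :: "('a \<Rightarrow> complex) set \<Rightarrow> int" and \<alpha>' :: "('b \<Rightarrow> complex) set \<Rightarrow> int" where
    "is_monomial_sum G (\<lambda>g. \<Sum>Z\<in>fst C. of_int (\<alpha> Z) * supercharacter G Z g)"
    "is_monomial_sum G' (\<lambda>g. \<Sum>Z\<in>fst C'. of_int (\<alpha>' Z) * supercharacter G' Z g)"
    "\<forall>Z\<in>fst C. \<alpha> Z \<ge> 0" "\<forall>Z\<in>fst C'. \<alpha>' Z \<ge> 0" "\<alpha> X > 0" "\<alpha>' X' > 0" "\<alpha> Y = 0 \<or> \<alpha>' Y' = 0"
  proof cases
    case 1
    obtain \<alpha> where \<alpha>: "is_monomial_sum G (\<lambda>g. \<Sum>Z\<in>fst C. of_int (\<alpha> Z) * supercharacter G Z g)"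
      "\<forall>Z\<in>fst C. \<alpha> Z \<ge> 0" "\<alpha> X > 0" "\<alpha> Y = 0"
      by (rule almost_monomialE[OF G parts(1,3) 1])
    obtain \<alpha>' where \<alpha>': "is_monomial_sum G' (\<lambda>g. \<Sum>Z\<in>fst C'. of_int (\<alpha>' Z) * supercharacter G' Z g)"
      "\<forall>Z\<in>fst C'. \<alpha>' Z \<ge> 0" "\<alpha>' X' > 0"
      by (rule G'.positive_coefficient[OF G' parts(2)])
    show thesis
      by (rule that[OF \<alpha>(1) \<alpha>'(1) \<alpha>(2) \<alpha>'(2) \<alpha>(3) \<alpha>'(3) disjI1[OF \<alpha>(4)]])
  next
    case 2
    obtain \<alpha>' where \<alpha>': "is_monomial_sum G' (\<lambda>g. \<Sum>Z\<in>fst C'. of_int (\<alpha>' Z) * supercharacter G' Z g)"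
      "\<forall>Z\<in>fst C'. \<alpha>' Z \<ge> 0" "\<alpha>' X' > 0" "\<alpha>' Y' = 0"
      by (rule almost_monomialE[OF G' parts(2,4) 2])
    obtain \<alpha> where \<alpha>: "is_monomial_sum G (\<lambda>g. \<Sum>Z\<in>fst C. of_int (\<alpha> Z) * supercharacter G Z g)"
      "\<forall>Z\<in>fst C. \<alpha> Z \<ge> 0" "\<alpha> X > 0"
      by (rule G.positive_coefficient[OF G parts(1)])
    show thesis
      by (rule that[OF \<alpha>(1) \<alpha>'(1) \<alpha>(2) \<alpha>'(2) \<alpha>(3) \<alpha>'(3) disjI2[OF \<alpha>'(4)]])
  qed
  then show "\<exists>\<beta>. is_monomial_sum (G \<times>\<times> G') (combination \<beta>) \<and>
      (\<forall>Z\<in>fst C. \<forall>Z'\<in>fst C'. \<beta> Z Z' \<ge> 0) \<and> \<beta> X X' > 0 \<and> \<beta> Y Y' = 0"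
    using combination_prod by (intro exI[of _ "\<lambda>Z Z'. \<alpha> Z * \<alpha>' Z'"]) auto
qed

text \<open>Over \<open>G'\<close> the supercharacters of parts other than \<open>T'\<close> sum to
  zero, and that of \<open>T'\<close> sums to the group order, which the average cancels. So the
  slice of \<open>\<beta>\<close> at \<open>T'\<close> survives unchanged.\<close>

lemma combination_average_snd:
  assumes \<beta>: "is_monomial_sum (G \<times>\<times> G') (combination \<beta>)"
    and T': "T' \<in> fst C'" "trivial_character G' \<in> T'"
  shows "is_monomial_sum G (\<lambda>g. \<Sum>Z\<in>fst C. of_int (\<beta> Z T') * supercharacter G Z g)"
proof (rule is_monomial_sum_cong[OF is_monomial_sum_average_snd[OF
      G.group_axioms G.finite_carrier G'.group_axioms G'.finite_carrier \<beta>]])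
  fix g
  let ?n = "of_nat (card (carrier G')) :: complex"
  have n: "?n \<noteq> 0" using G'.finite_carrier by (auto simp: card_eq_0_iff)
  have "trivial_character G' \<in> Z' \<longleftrightarrow> Z' = T'" if "Z' \<in> fst C'" for Z'
    using G'.trivial_part T' that by blast
  then have sum: "(\<Sum>g'\<in>carrier G'. supercharacter G' Z' g') = (if Z' = T' then ?n else 0)" if "Z' \<in> fst C'" for Z'
    using G'.sum_supercharacter[OF that] that by simp
  have "(\<Sum>g'\<in>carrier G'. combination \<beta> (g, g')) = (\<Sum>Z\<in>fst C. \<Sum>Z'\<in>fst C'.
      of_int (\<beta> Z Z') * supercharacter G Z g * (\<Sum>g'\<in>carrier G'. supercharacter G' Z' g'))"
    by (simp add: sum_distrib_left mult.assoc) (subst sum.swap, intro sum.cong refl sum.swap)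
  also have "\<dots> = (\<Sum>Z\<in>fst C. \<Sum>Z'\<in>fst C'. if Z' = T' then of_int (\<beta> Z T') * supercharacter G Z g * ?n else 0)"
    using sum by (intro sum.cong refl) auto
  also have "\<dots> = (\<Sum>Z\<in>fst C. of_int (\<beta> Z T') * supercharacter G Z g) * ?n"
    using T'(1) G'.finite_parts by (simp add: sum_distrib_right)
  finally show "(\<Sum>g'\<in>carrier G'. combination \<beta> (g, g')) / ?n =
      (\<Sum>Z\<in>fst C. of_int (\<beta> Z T') * supercharacter G Z g)"
    using n by simp
qed

lemma combination_average_fst:
  assumes \<beta>: "is_monomial_sum (G \<times>\<times> G') (combination \<beta>)"
    and T: "T \<in> fst C" "trivial_character G \<in> T"
  shows "is_monomial_sum G' (\<lambda>g. \<Sum>Z\<in>fst C'. of_int (\<beta> T Z) * supercharacter G' Z g)"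
proof (rule is_monomial_sum_cong[OF is_monomial_sum_average_fst[OF
      G.group_axioms G.finite_carrier G'.group_axioms G'.finite_carrier \<beta>]])
  fix g'
  let ?n = "of_nat (card (carrier G)) :: complex"
  have n: "?n \<noteq> 0" using G.finite_carrier by (auto simp: card_eq_0_iff)
  have "trivial_character G \<in> Z \<longleftrightarrow> Z = T" if "Z \<in> fst C" for Z
    using G.trivial_part T that by blast
  then have sum: "(\<Sum>g\<in>carrier G. supercharacter G Z g) = (if Z = T then ?n else 0)" if "Z \<in> fst C" for Z
    using G.sum_supercharacter[OF that] that by simp
  have "(\<Sum>g\<in>carrier G. combination \<beta> (g, g')) = (\<Sum>Z\<in>fst C. \<Sum>Z'\<in>fst C'.
      of_int (\<beta> Z Z') * supercharacter G' Z' g' * (\<Sum>g\<in>carrier G. supercharacter G Z g))"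
    by (simp add: sum_distrib_left mult_ac) (subst sum.swap, intro sum.cong refl sum.swap)
  also have "\<dots> = (\<Sum>Z\<in>fst C. if Z = T then \<Sum>Z'\<in>fst C'. of_int (\<beta> T Z') * supercharacter G' Z' g' * ?n else 0)"
    using sum by (intro sum.cong refl) auto
  also have "\<dots> = (\<Sum>Z'\<in>fst C'. of_int (\<beta> T Z') * supercharacter G' Z' g') * ?n"
    using T(1) G.finite_parts by (simp add: sum_distrib_right)
  finally show "(\<Sum>g\<in>carrier G. combination \<beta> (g, g')) / ?n =
      (\<Sum>Z'\<in>fst C'. of_int (\<beta> T Z') * supercharacter G' Z' g')"
    using n by simp
qed

text \<open>To separate \<open>X\<close> from \<open>Y\<close> in one factor, separate
  \<open>(X, T')\<close> from \<open>(Y, T')\<close> in the product, with \<open>T'\<close> the part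
  of the trivial character. Averaging keeps exactly the coefficients \<open>\<beta> Z T'\<close>;
  the other factor is symmetric.\<close>

lemma almost_monomial_factors:
  assumes "almost_monomial (G \<times>\<times> G') (product_theory C C')"
  shows "almost_monomial G C" "almost_monomial G' C'"
proof -
  obtain T where T: "T \<in> fst C" "trivial_character G \<in> T" using G.trivial_part by blast
  obtain T' where T': "T' \<in> fst C'" "trivial_character G' \<in> T'" using G'.trivial_part by blast
  note prod = assms[unfolded almost_monomial_product_iff, rule_format]
  show "almost_monomial G C"
    unfolding almost_monomial_iff
  proof (intro ballI impI)
    fix X Y assume "X \<in> fst C" "Y \<in> fst C" "X \<noteq> Y"
    then obtain \<beta> where "is_monomial_sum (G \<times>\<times> G') (combination \<beta>)"
      "\<forall>Z\<in>fst C. \<forall>Z'\<in>fst C'. \<beta> Z Z' \<ge> 0" "\<beta> X T' > 0" "\<beta> Y T' = 0"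
      using prod[of X T' Y T'] T' by auto
    then show "\<exists>\<alpha>. is_monomial_sum G (\<lambda>g. \<Sum>Z\<in>fst C. of_int (\<alpha> Z) * supercharacter G Z g) \<and>
        (\<forall>Z\<in>fst C. \<alpha> Z \<ge> 0) \<and> \<alpha> X > 0 \<and> \<alpha> Y = 0"
      using combination_average_snd[OF _ T'] T'(1) by (intro exI[of _ "\<lambda>Z. \<beta> Z T'"]) auto
  qed
  show "almost_monomial G' C'"
    unfolding almost_monomial_iff
  proof (intro ballI impI)
    fix X Y assume "X \<in> fst C'" "Y \<in> fst C'" "X \<noteq> Y"
    then obtain \<beta> where "is_monomial_sum (G \<times>\<times> G') (combination \<beta>)"
      "\<forall>Z\<in>fst C. \<forall>Z'\<in>fst C'. \<beta> Z Z' \<ge> 0" "\<beta> T X > 0" "\<beta> T Y = 0"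
      using prod[of T X T Y] T by auto
    then show "\<exists>\<alpha>. is_monomial_sum G' (\<lambda>g. \<Sum>Z\<in>fst C'. of_int (\<alpha> Z) * supercharacter G' Z g) \<and>
        (\<forall>Z\<in>fst C'. \<alpha> Z \<ge> 0) \<and> \<alpha> X > 0 \<and> \<alpha> Y = 0"
      using combination_average_fst[OF _ T] T(1) by (intro exI[of _ "\<beta> T"]) auto
  qed
qed

end

theorem theorem2p14:
  fixes G :: "('a, 'm) monoid_scheme" and G' :: "('b, 'n) monoid_scheme"
    and C :: "'a sct" and C' :: "'b sct"
  assumes "group G" and "finite (carrier G)"
    and "group G'" and "finite (carrier G')"
    and "supercharacter_theory G C" and "supercharacter_theory G' C'"
  shows "almost_monomial G C \<and> almost_monomial G' C' \<longleftrightarrow>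
         almost_monomial (G \<times>\<times> G') (product_theory C C')"
proof -
  interpret finite_group_sct_pair G C G' C'
    using assms by (intro finite_group_sct_pair.intro finite_group_sct.intro finite_group_sct_axioms.intro)
  show ?thesis
    using almost_monomial_product almost_monomial_factors by blast
qed

end
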